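(* Let $0<d<\pi/2$, $\mathscr{D}_d=\{\zeta\in\mathbb{C}:|\Im\zeta|<d\}$, and let $i\in\{2,3\}$, with $\psi_2(t)=e^t$, $\psi_3(t)=\operatorname{arcsinh}(e^t)$, $E_2(z;\alpha,\beta)=z^{\alpha-1}(1+z^2)^{-(\alpha+\beta)/2}$, $E_3(z;\alpha,\beta)=\left(\frac{z}{1+z}\right)^{\alpha-1}e^{-\beta z}$. Assume $f$ is analytic on $\psi_i(\mathscr{D}_d)$ and there are constants $K,\alpha,\beta>0$ with $|f(z)|\le K|E_i(z;\alpha,\beta)|$ for all $z\in\psi_i(\mathscr{D}_d)$. Let $\mu=\min\{\alpha,\beta\}$, let $n$ be a positive integer, $h=\sqrt{\pi d/(\mu n)}$, and let $M=n$, $N=\lceil\alpha n/\beta\rceil$ if $\mu=\alpha$, and $N=n$, $M=\lceil\beta n/\alpha\rceil$ if $\mu=\beta$. Then \[ \sup_{\tau\in(0,\infty)}\left|\int_0^{\tau}f(t)\,dt-\sum_{k=-M}^{N}f(\psi_i(kh))\psi_i'(kh)J(k,h)(\psi_i^{-1}(\tau))\right|\le C_ie^{-\sqrt{\pi d\mu n}}, \] where \[ C_2=\frac{2K}{\mu}\left\{\frac{1}{(1-e^{-2\sqrt{\pi d\mu}})(\cos d)^{(\alpha+\beta)/2}}\sqrt{\frac{\pi}{d\mu}}+1.1\right\},\] \[ C_3=\frac{2K}{\mu}\left\{\frac{2^{1+\beta/2}c_{\alpha,d}}{(1-e^{-2\sqrt{\pi d\mu}})(\cos d)^{(\alpha+\beta)/2}}\sqrt{\frac{\pi}{d\mu}}+1.1\cdot2^{(1-\alpha+|1-\alpha|)/2}\right\},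 \] and $c_{\alpha,d}=\{2(1+1/\cos d)\}^{(1-\alpha)/2}$ if $0<\alpha<1$, $c_{\alpha,d}=2^{(\alpha-1)/2}$ if $\alpha\ge1$.
   Context: $J(k,h)(x)=h\left\{\frac12+\frac1\pi\operatorname{Si}[\pi(x/h-k)]\right\}$ with $\operatorname{Si}(x)=\int_0^x\frac{\sin\sigma}{\sigma}d\sigma$. $\psi_i^{-1}$ is the inverse of $\psi_i$ on the reals. Complex powers use principal branches. *)

theory Defs
  imports "HOL-Analysis.Analysis" "HOL-Probability.Sinc_Integral"
begin

definition strip :: "real \<Rightarrow> complex set" where
  "strip d = {z. \<bar>Im z\<bar> < d}"

definition psiC :: "nat \<Rightarrow> complex \<Rightarrow> complex" where
  "psiC i z = (if i = 2 then exp z else arsinh (exp z))"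

definition psiR :: "nat \<Rightarrow> real \<Rightarrow> real" where
  "psiR i t = (if i = 2 then exp t else arsinh (exp t))"

definition E :: "nat \<Rightarrow> real \<Rightarrow> real \<Rightarrow> complex \<Rightarrow> complex" where
  "E i \<alpha> \<beta> z = (if i = 2
      then z powr (of_real (\<alpha> - 1)) * (1 + z\<^sup>2) powr (of_real (- (\<alpha> + \<beta>) / 2))
      else (z / (1 + z)) powr (of_real (\<alpha> - 1)) * exp (- of_real \<beta> * z))"

definition J :: "int \<Rightarrow> real \<Rightarrow> real \<Rightarrow> real" where
  "J k h x = h * (1/2 + Si (pi * (x / h - real_of_int k)) / pi)"

definition c_ad :: "real \<Rightarrow> real \<Rightarrow> real" where
  "c_ad \<alpha> d = (if \<alpha> < 1 then (2 * (1 + 1 / cos d)) powr ((1 - \<alpha>) / 2)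
               else 2 powr ((\<alpha> - 1) / 2))"

definition C_const :: "nat \<Rightarrow> real \<Rightarrow> real \<Rightarrow> real \<Rightarrow> real \<Rightarrow> real" where
  "C_const i K \<alpha> \<beta> d = (let \<mu> = min \<alpha> \<beta> in
     if i = 2 then
       2 * K / \<mu> * (1 / ((1 - exp (- 2 * sqrt (pi * d * \<mu>))) * cos d powr ((\<alpha> + \<beta>) / 2))
                      * sqrt (pi / (d * \<mu>)) + 1.1)
     else
       2 * K / \<mu> * (2 powr (1 + \<beta> / 2) * c_ad \<alpha> d
                      / ((1 - exp (- 2 * sqrt (pi * d * \<mu>))) * cos d powr ((\<alpha> + \<beta>) / 2))
                      * sqrt (pi / (d * \<mu>))
                    + 1.1 * 2 powr ((1 - \<alpha> + \<bar>1 - \<alpha>\<bar>) / 2)))"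

end

theory Submission
  imports Defs "HOL-Complex_Analysis.Complex_Analysis" "HOL-Real_Asymp.Real_Asymp"
begin

text \<open>
  Put $F(\zeta) = f(\psi(\zeta))\,\psi'(\zeta)$, which is holomorphic on the strip and decays like
  $e^{\alpha x}$ and $e^{-\beta x}$. The residue theorem on a rectangle represents
  $F(x) - \sum_k F(kh)\,\mathrm{sinc}(x/h-k)$ as a contour integral with kernel
  $\sin(\pi x/h) / ((\zeta-x)\sin(\pi\zeta/h))$. Integrating in $x$ turns the sinc functions into
  differences of the $J(k,h)$, and an integration by parts shows that
  $\int_a^b \sin(\pi x/h)/(\zeta-x)\,dx$ is at most $h/|\Im\zeta|$ whatever $a$ and $b$ are. Letting the
  rectangle exhaust the strip and $a \to -\infty$ gives the discretization error, of order
  $1/\sinh(\pi d/h)$; the truncation error is a geometric tail, because $|J(k,h)| \le 1.1\,h$.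

  The bounds on $F$ are stated for $w = e^\zeta$ in a sector $c\,|w| \le \Re w$. Taking $c = \cos d$ covers
  the strip (discretization), taking $c = 1$ covers the real line (truncation).
\<close>

subsection \<open>The sine integral\<close>

text \<open>The step size is the point where both errors meet: with h = sqrt(pi d / (mu n)), the
  exponents pi d / h and mu n h both equal sqrt(pi d mu n). The two terms of C_i keep their separate
  origins. The first comes from the strip and carries cos d; the second comes from samples on the
  real axis, so it does not, and its 1.1 is 1/2 + 0.6 with 0.6 pi a bound for the sine integral. The
  limits cannot be taken at once: the contour formula needs a bounded interval inside the rectangle,
  and F is controlled only on the open strip. Uniformity rescues them: the kernel bound does not see
  the interval, and the truncation bound sees neither the number of samples nor the evaluation
  point. For i = 3 the obstacle is to compare z = arsinh w with w in both directions, because the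
  power alpha - 1 of z/(1+z) changes sign at alpha = 1. This uses Re z >= 0, an upper bound for |z|
  from the derivative of arsinh, and a lower bound from the derivative of sinh.\<close>

lemma Si_0: "Si 0 = 0"
  by (simp add: Si_def zero_ereal_def[symmetric])

lemma sinc_nonneg: "0 \<le> x \<Longrightarrow> x \<le> pi \<Longrightarrow> 0 \<le> sinc x"
  by (auto simp: sin_ge_zero)

lemma Si_mono_on_0_pi:
  assumes "0 \<le> x" "x \<le> y" "y \<le> pi"
  shows "Si x \<le> Si y"
proof (rule DERIV_nonneg_imp_nondecreasing[OF assms(2)])
  fix t assume "x \<le> t" "t \<le> y"
  then show "\<exists>D. (Si has_real_derivative D) (at t) \<and> 0 \<le> D"
    using assms sinc_nonneg[of t] DERIV_Si[of t] by auto
qed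

text \<open>
  Integration by parts of $\sin t/t$ produces these two monotone companions of the sine integral; they
  show that its global maximum is attained at $\pi$, and bound its value there by the value at $3$.
\<close>

lemma Si_plus_decreasing:
  fixes x y :: real
  assumes "0 < x" "x \<le> y"
  shows "Si y + (1 + cos y) / y \<le> Si x + (1 + cos x) / x"
proof (rule DERIV_nonpos_imp_nonincreasing[OF assms(2), where f = "\<lambda>x. Si x + (1 + cos x) / x"])
  fix t assume "x \<le> t" "t \<le> y"
  then have "t > 0" using assms by simp
  then have "((\<lambda>x. Si x + (1 + cos x) / x) has_real_derivative - (1 + cos t) / t\<^sup>2) (at t)"
    by (auto intro!: derivative_eq_intros DERIV_Si simp: field_simps power2_eq_square)
  moreover have "- (1 + cos t) / t\<^sup>2 \<le> 0"
    using cos_ge_minus_one[of t] by (intro divide_nonpos_nonneg) (auto simp: add_nonneg_nonneg)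
  ultimately show "\<exists>D. ((\<lambda>x. Si x + (1 + cos x) / x) has_real_derivative D) (at t) \<and> D \<le> 0"
    by blast
qed

lemma Si_minus_increasing:
  fixes x y :: real
  assumes "0 < x" "x \<le> y"
  shows "Si x - (1 - cos x) / x \<le> Si y - (1 - cos y) / y"
proof (rule DERIV_nonneg_imp_nondecreasing[OF assms(2), where f = "\<lambda>x. Si x - (1 - cos x) / x"])
  fix t assume "x \<le> t" "t \<le> y"
  then have "t > 0" using assms by simp
  then have "((\<lambda>x. Si x - (1 - cos x) / x) has_real_derivative (1 - cos t) / t\<^sup>2) (at t)"
    by (auto intro!: derivative_eq_intros DERIV_Si simp: field_simps power2_eq_square)
  moreover have "0 \<le> (1 - cos t) / t\<^sup>2"
    by (intro divide_nonneg_nonneg) auto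
  ultimately show "\<exists>D. ((\<lambda>x. Si x - (1 - cos x) / x) has_real_derivative D) (at t) \<and> 0 \<le> D"
    by blast
qed

section \<open>Numerical bound for the sine integral\<close>

lemma sin_le_Taylor:
  fixes x :: real
  assumes "0 \<le> x"
  shows "sin x \<le> x - x^3/6 + x^5/120 - x^7/5040 + x^9/362880"
proof -
  have "sin x - (\<Sum>m<9. sin_coeff m * x ^ m) \<le> inverse (fact 9) * \<bar>x\<bar> ^ 9"
    by (rule abs_le_D1[OF Maclaurin_sin_bound])
  moreover have "{..<9::nat} = {0, 1, 2, 3, 4, 5, 6, 7, 8}" by auto
  ultimately show ?thesis using assms
    by (simp add: sin_coeff_def fact_numeral)
qed

text \<open>The point 3 stands in for pi because there the bound is rational arithmetic.\<close>

lemma Si_3_le: "Si 3 \<le> 1.85"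
proof -
  \<comment> \<open>Termwise integral of the Taylor bound for sin t divided by t: 18 = 3 * 3!, 600 =
    5 * 5!, and so on. \<open>P 3\<close> is about 1.849.\<close>
  define P :: "real \<Rightarrow> real"
    where "P x = x - x^3/18 + x^5/600 - x^7/35280 + x^9/3265920" for x
  have "Si 3 - P 3 \<le> Si 0 - P 0"
  proof (rule DERIV_nonpos_imp_nonincreasing[where f = "\<lambda>x. Si x - P x"])
    fix t :: real assume t: "0 \<le> t" "t \<le> 3"
    define q where "q = 1 - t^2/6 + t^4/120 - t^6/5040 + t^8/362880"
    have "((\<lambda>x. Si x - P x) has_real_derivative sinc t - q) (at t)"
      unfolding P_def q_def by (auto intro!: derivative_eq_intros DERIV_Si simp: field_simps)
    moreover have "sinc t - q \<le> 0"
    proof (cases "t = 0")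
      case False
      have "sin t \<le> t * q"
        using sin_le_Taylor[OF t(1)] by (simp add: q_def eval_nat_numeral field_simps)
      then show ?thesis using False t by (simp add: field_simps)
    qed (simp add: q_def)
    ultimately show "\<exists>D. ((\<lambda>x. Si x - P x) has_real_derivative D) (at t) \<and> D \<le> 0"
      by blast
  qed simp
  then show ?thesis by (simp add: P_def Si_0)
qed

text \<open>The decreasing companion equals \<open>Si pi\<close> at pi, where 1 + cos vanishes, so
  passing from 3 to pi costs only (1 + cos 3)/3. This is tiny, since 1 + cos 3 = 2 sin^2((pi -
  3)/2).\<close>

lemma Si_pi_le: "Si pi \<le> 0.6 * pi"
proof -
  have "Si pi \<le> Si 3 + (1 + cos 3) / 3"
    using Si_plus_decreasing[of 3 pi] pi_gt3 by simp
  also have "cos 3 = - cos (pi - 3)" by simp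
  also have "- cos (pi - 3) = 2 * (sin ((pi - 3) / 2))\<^sup>2 - 1"
    using cos_double_sin[of "(pi - 3) / 2"] by (simp add: diff_divide_distrib)
  also have "(sin ((pi - 3) / 2))\<^sup>2 \<le> 0.1\<^sup>2"
  proof (rule power_mono)
    show "sin ((pi - 3) / 2) \<le> 0.1"
      using sin_x_le_x[of "(pi - 3)/2"] pi_gt3 pi_approx by simp
    show "0 \<le> sin ((pi - 3) / 2)"
      using pi_gt3 pi_approx by (intro sin_ge_zero) auto
  qed
  finally show ?thesis using Si_3_le pi_approx by (simp add: power2_eq_square)
qed

lemma abs_Si_le: "\<bar>Si x\<bar> \<le> 0.6 * pi"
proof -
  have *: "\<bar>Si x\<bar> \<le> 0.6 * pi" if "0 \<le> x" for x
  proof (cases "x \<le> pi")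
    case True
    then show ?thesis
      using Si_mono_on_0_pi[of 0 x] Si_mono_on_0_pi[of x pi] that Si_pi_le by (simp add: Si_0)
  next
    case False
    have "Si x + (1 + cos x) / x \<le> Si pi"
      using Si_plus_decreasing[of pi x] False by simp
    moreover have "0 \<le> (1 + cos x) / x"
      using that cos_ge_minus_one[of x] by (intro divide_nonneg_nonneg) linarith+
    \<comment> \<open>The lower bound: \<open>Si x\<close> is at least
      \<open>Si pi - 2 / pi\<close>, hence at least -2/pi, well above -0.6 pi.\<close>
    moreover have "Si pi - 2 / pi \<le> Si x - (1 - cos x) / x"
      using Si_minus_increasing[of pi x] False by simp
    moreover have "0 \<le> (1 - cos x) / x"
      using that by (intro divide_nonneg_nonneg) auto
    moreover have "0 \<le> Si pi"
      using Si_mono_on_0_pi[of 0 pi] by (simp add: Si_0)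
    moreover have "2 / pi \<le> 0.6 * pi"
      using pi_gt3 mult_mono[of 3 pi 3 pi] by (simp add: field_simps)
    ultimately show ?thesis using Si_pi_le by linarith
  qed
  show ?thesis
    using *[of x] *[of "-x"] Si_neg[of "-x"] by (cases "0 \<le> x") auto
qed

section \<open>The functions J(k,h)\<close>

lemma abs_J_le:
  assumes "0 < h"
  shows "\<bar>J k h x\<bar> \<le> 1.1 * h"
proof -
  have "\<bar>1/2 + Si (pi * (x / h - k)) / pi\<bar> \<le> 1.1"
    using abs_Si_le[of "pi * (x / h - k)"] by (simp add: abs_if field_simps split: if_splits)
  then show ?thesis using assms unfolding J_def
    by (simp add: abs_mult mult.commute)
qed

lemma Si_at_bot: "(Si \<longlongrightarrow> - pi / 2) at_bot"
proof -
  have "((\<lambda>x. - Si x) \<longlongrightarrow> - (pi / 2)) at_top"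
    by (intro tendsto_intros Si_at_top)
  then have "((\<lambda>x. Si (- x)) \<longlongrightarrow> - (pi / 2)) at_top"
    by (rule Lim_transform_eventually)
      (auto intro!: eventually_mono[OF eventually_ge_at_top[of 0]] simp: Si_neg)
  then show ?thesis by (simp add: filterlim_at_bot_mirror)
qed

text \<open>The summand 1/2 in J selects the antiderivative of the shifted sinc function that
  vanishes at minus infinity. Hence the differences J(b) - J(a) become J(b) in the limit.\<close>

lemma J_at_bot:
  assumes "0 < h"
  shows "(J k h \<longlongrightarrow> 0) at_bot"
proof -
  have lim: "LIM x at_bot. pi * (x / h - real_of_int k) :> at_bot"
    using assms by real_asymp
  have "((\<lambda>x. h * (1/2 + Si (pi * (x / h - real_of_int k)) / pi)) \<longlongrightarrow> h * (1/2 + (- pi / 2) / pi)) at_bot"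
    by (intro tendsto_intros filterlim_compose[OF Si_at_bot lim]) auto
  then show ?thesis by (simp add: J_def[abs_def])
qed

lemma has_integral_sinc_shift:
  assumes "0 < h" "a \<le> b"
  shows "((\<lambda>x. sinc (pi * (x / h - real_of_int k))) has_integral (J k h b - J k h a)) {a..b}"
proof (rule fundamental_theorem_of_calculus[OF assms(2)])
  fix x assume "x \<in> {a..b}"
  have "((\<lambda>x. Si (pi * (x / h - real_of_int k))) has_real_derivative
           sinc (pi * (x / h - real_of_int k)) * (pi / h)) (at x)"
    using assms by (intro DERIV_chain2[OF DERIV_Si]) (auto intro!: derivative_eq_intros)
  then have "(J k h has_real_derivative sinc (pi * (x / h - real_of_int k))) (at x)"
    unfolding J_def[abs_def] using assms by (auto intro!: derivative_eq_intros)
  then show "(J k h has_vector_derivative sinc (pi * (x / h - real_of_int k))) (at x within {a..b})"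
    by (simp add: has_real_derivative_iff_has_vector_derivative has_vector_derivative_at_within)
qed

subsection \<open>The integrated kernel\<close>

text \<open>
  With this inequality the two boundary terms of the integration by parts are absorbed by the
  $\arctan$ terms, so that the kernel bound is exactly $h/\delta$.
\<close>

lemma inverse_sqrt_plus_arctan_le: "1 / sqrt (1 + u\<^sup>2) + arctan u \<le> pi / 2"
proof -
  have "1 / sqrt (1 + u\<^sup>2) = sin (pi / 2 - arctan u)"
    by (simp add: sin_diff cos_arctan)
  also have "\<dots> \<le> pi / 2 - arctan u"
    using arctan_ubound[of u] by (intro sin_x_le_x) simp
  finally show ?thesis by simp
qed

text \<open>Taking moduli at once would cost a logarithm of b - a. After one integration by parts
  the denominator is squared, its modulus is a Cauchy density, and its integral is a difference of
  arctangents. Together with the boundary terms this is at most pi, which cancels the pi in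
  h/pi.\<close>

lemma norm_kernel_integral_le:
  fixes \<zeta> :: complex
  assumes h: "0 < h" and im: "\<bar>Im \<zeta>\<bar> = \<delta>" "0 < \<delta>" and ab: "a \<le> b"
  shows "cmod (integral {a..b} (\<lambda>x. of_real (sin (pi * x / h)) / (\<zeta> - of_real x))) \<le> h / \<delta>"
proof -
  define t where "t = Re \<zeta>"
  have nz: "\<zeta> - of_real x \<noteq> 0" for x
    using im by (auto simp: complex_eq_iff)
  have norm: "cmod (\<zeta> - of_real x) = sqrt ((x - t)\<^sup>2 + \<delta>\<^sup>2)" for x
    using im by (auto simp: cmod_def t_def power2_commute)
  have norm': "cmod (1 / (\<zeta> - of_real x)) = (1 / \<delta>) * (1 / sqrt (1 + ((x - t) / \<delta>)\<^sup>2))" for x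
  proof -
    have "sqrt ((x - t)\<^sup>2 + \<delta>\<^sup>2) = sqrt (\<delta>\<^sup>2 * (1 + ((x - t) / \<delta>)\<^sup>2))"
      using im(2) by (simp add: field_simps)
    also have "\<dots> = \<delta> * sqrt (1 + ((x - t) / \<delta>)\<^sup>2)"
      using im(2) by (simp add: real_sqrt_mult)
    finally show ?thesis by (simp add: norm_divide norm)
  qed
  \<comment> \<open>\<open>P\<close> is the boundary term, \<open>Q\<close> the integrand that
    remains, and P' = G - (h/pi) Q.\<close>
  define P where "P x = - of_real (h / pi) * of_real (cos (pi * x / h)) / (\<zeta> - of_real x)" for x :: real
  define Q where "Q x = of_real (cos (pi * x / h)) / (\<zeta> - of_real x)\<^sup>2" for x :: real
  define G where "G x = of_real (sin (pi * x / h)) / (\<zeta> - of_real x)" for x :: real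
  have dP: "(P has_vector_derivative (G x - of_real (h / pi) * Q x)) (at x within {a..b})" for x
  proof -
    have 1: "((\<lambda>z. - of_real (h / pi) * cos (of_real (pi / h) * z) / (\<zeta> - z)) has_field_derivative
       (sin (of_real (pi / h) * of_real x) / (\<zeta> - of_real x)
         - of_real (h / pi) * (cos (of_real (pi / h) * of_real x) / (\<zeta> - of_real x)\<^sup>2))) (at (of_real x))"
    proof -
      have d1: "((\<lambda>z. - of_real (h / pi) * cos (of_real (pi / h) * z)) has_field_derivative
              sin (of_real (pi / h) * of_real x)) (at (complex_of_real x))"
        using h by (auto intro!: derivative_eq_intros)
      have d2: "((\<lambda>z. \<zeta> - z) has_field_derivative -1) (at (complex_of_real x))"
        by (auto intro!: derivative_eq_intros)
      show ?thesis
        using DERIV_divide[OF d1 d2 nz] nz[of x] by (simp add: power2_eq_square diff_divide_distrib)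
    qed
    have "((\<lambda>x. - of_real (h / pi) * cos (of_real (pi / h) * of_real x) / (\<zeta> - of_real x))
        has_vector_derivative (sin (of_real (pi / h) * of_real x) / (\<zeta> - of_real x)
         - of_real (h / pi) * (cos (of_real (pi / h) * of_real x) / (\<zeta> - of_real x)\<^sup>2))) (at x within {a..b})"
      by (rule has_vector_derivative_real_field[OF 1])
    moreover have "P = (\<lambda>x. - of_real (h / pi) * cos (of_real (pi / h) * of_real x) / (\<zeta> - of_real x))"
      by (rule ext) (simp add: P_def flip: cos_of_real)
    moreover have "G x - of_real (h / pi) * Q x = sin (of_real (pi / h) * of_real x) / (\<zeta> - of_real x)
         - of_real (h / pi) * (cos (of_real (pi / h) * of_real x) / (\<zeta> - of_real x)\<^sup>2)"
      by (simp add: G_def Q_def flip: cos_of_real sin_of_real)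
    ultimately show ?thesis by simp
  qed
  have cQ: "continuous_on {a..b} Q"
    unfolding Q_def using nz h by (auto intro!: continuous_intros)
  have iQ: "Q integrable_on {a..b}"
    by (rule integrable_continuous_real[OF cQ])
  have "((\<lambda>x. G x - of_real (h / pi) * Q x) has_integral (P b - P a)) {a..b}"
    by (rule fundamental_theorem_of_calculus[OF ab dP])
  moreover have "((\<lambda>x. of_real (h / pi) * Q x) has_integral of_real (h / pi) * integral {a..b} Q) {a..b}"
    by (intro has_integral_mult_right integrable_integral iQ)
  ultimately have "((\<lambda>x. G x - of_real (h / pi) * Q x + of_real (h / pi) * Q x) has_integral
       (P b - P a + of_real (h / pi) * integral {a..b} Q)) {a..b}"
    by (rule has_integral_add)
  then have intG: "integral {a..b} G = P b - P a + of_real (h / pi) * integral {a..b} Q"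
    by (simp add: integral_unique)
  have dA: "((\<lambda>x. (1 / \<delta>) * arctan ((x - t) / \<delta>)) has_vector_derivative (1 / ((x - t)\<^sup>2 + \<delta>\<^sup>2))) (at x within {a..b})" for x
  proof -
    have "((\<lambda>x. (1 / \<delta>) * arctan ((x - t) / \<delta>)) has_real_derivative
            (1 / \<delta>) * (inverse (1 + ((x - t) / \<delta>)\<^sup>2) * (1 / \<delta>))) (at x)"
      by (intro DERIV_cmult DERIV_chain2[OF DERIV_arctan]) (use im(2) in \<open>auto intro!: derivative_eq_intros\<close>)
    also have "(1 / \<delta>) * (inverse (1 + ((x - t) / \<delta>)\<^sup>2) * (1 / \<delta>)) = 1 / (\<delta>\<^sup>2 * (1 + ((x - t) / \<delta>)\<^sup>2))"
      by (simp add: divide_simps power2_eq_square)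
    also have "\<delta>\<^sup>2 * (1 + ((x - t) / \<delta>)\<^sup>2) = (x - t)\<^sup>2 + \<delta>\<^sup>2"
      using im(2) by (simp add: field_simps)
    finally show ?thesis
      by (simp add: has_real_derivative_iff_has_vector_derivative has_vector_derivative_at_within)
  qed
  define W where "W x = arctan ((x - t) / \<delta>)" for x
  have iA: "((\<lambda>x. 1 / ((x - t)\<^sup>2 + \<delta>\<^sup>2)) has_integral ((1 / \<delta>) * W b - (1 / \<delta>) * W a)) {a..b}"
    unfolding W_def by (rule fundamental_theorem_of_calculus[OF ab dA])
  have "cmod (integral {a..b} Q) \<le> integral {a..b} (\<lambda>x. 1 / ((x - t)\<^sup>2 + \<delta>\<^sup>2))"
  proof (rule integral_norm_bound_integral[OF iQ])
    show "(\<lambda>x. 1 / ((x - t)\<^sup>2 + \<delta>\<^sup>2)) integrable_on {a..b}"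
      using iA by (rule has_integral_integrable)
    show "cmod (Q x) \<le> 1 / ((x - t)\<^sup>2 + \<delta>\<^sup>2)" for x
      using abs_cos_le_one[of "pi * x / h"]
      by (simp add: Q_def norm_divide norm_power norm divide_right_mono)
  qed
  then have bQ: "cmod (integral {a..b} Q) \<le> (1 / \<delta>) * W b - (1 / \<delta>) * W a"
    using iA by (simp add: integral_unique)
  have bP: "cmod (P x) \<le> (h / pi) * ((1 / \<delta>) * (1 / sqrt (1 + ((x - t) / \<delta>)\<^sup>2)))" for x
  proof -
    have "cmod (P x) = (h / pi) * (\<bar>cos (pi * x / h)\<bar> * cmod (1 / (\<zeta> - of_real x)))"
      using h by (simp add: P_def norm_mult norm_divide)
    also have "\<dots> \<le> (h / pi) * (1 * cmod (1 / (\<zeta> - of_real x)))"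
      using h by (intro mult_left_mono mult_right_mono) auto
    finally show ?thesis by (simp only: norm' mult_1)
  qed
  \<comment> \<open>Each end point uses half of pi. At the left end the inequality is applied to -(a
    - t)/\<delta>, since arctan is odd.\<close>
  have "1 / sqrt (1 + ((b - t) / \<delta>)\<^sup>2) + W b \<le> pi / 2"
    unfolding W_def by (rule inverse_sqrt_plus_arctan_le)
  moreover have "1 / sqrt (1 + ((a - t) / \<delta>)\<^sup>2) - W a \<le> pi / 2"
    using inverse_sqrt_plus_arctan_le[of "- ((a - t) / \<delta>)"] by (simp add: W_def arctan_minus del: minus_divide_left)
  ultimately have s: "1 / sqrt (1 + ((b - t) / \<delta>)\<^sup>2) + 1 / sqrt (1 + ((a - t) / \<delta>)\<^sup>2) + (W b - W a) \<le> pi"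
    by linarith
  have "cmod (integral {a..b} G) \<le> cmod (P b) + cmod (P a) + (h / pi) * cmod (integral {a..b} Q)"
  proof -
    have "cmod (integral {a..b} G) \<le> cmod (P b - P a) + cmod (of_real (h / pi) * integral {a..b} Q)"
      unfolding intG by (rule norm_triangle_ineq)
    also have "cmod (of_real (h / pi) * integral {a..b} Q) = (h / pi) * cmod (integral {a..b} Q)"
      unfolding norm_mult norm_of_real using h by simp
    finally show ?thesis using norm_triangle_ineq4[of "P b" "P a"] by linarith
  qed
  also have "\<dots> \<le> (h / pi) * ((1 / \<delta>) * (1 / sqrt (1 + ((b - t) / \<delta>)\<^sup>2)))
      + (h / pi) * ((1 / \<delta>) * (1 / sqrt (1 + ((a - t) / \<delta>)\<^sup>2))) + (h / pi) * ((1 / \<delta>) * W b - (1 / \<delta>) * W a)"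
    using h by (intro add_mono bP mult_left_mono bQ) auto
  also have "\<dots> = (h / (pi * \<delta>)) * (1 / sqrt (1 + ((b - t) / \<delta>)\<^sup>2) + 1 / sqrt (1 + ((a - t) / \<delta>)\<^sup>2) + (W b - W a))"
    by (simp add: algebra_simps)
  also have "\<dots> \<le> (h / (pi * \<delta>)) * pi"
    using s h im(2) by (intro mult_left_mono) auto
  finally show ?thesis by (simp add: G_def[abs_def])
qed

subsection \<open>Contour integrals over rectangles\<close>

text \<open>Fubini on a parametrized segment. It moves the x-integration inside the contour
  integral, where the oscillation of the kernel can be exploited; the integrability claim later lets
  the rectangle be split into sides.\<close>

lemma integral_contour_integral_linepath_swap:
  fixes f :: "complex \<Rightarrow> real \<Rightarrow> complex"
  assumes cont: "continuous_on (closed_segment p q \<times> {a..b}) (\<lambda>(z, x). f z x)"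
  shows "((\<lambda>x. contour_integral (linepath p q) (\<lambda>z. f z x)) has_integral
            contour_integral (linepath p q) (\<lambda>z. integral {a..b} (f z))) {a..b}"
    and "(\<lambda>z. integral {a..b} (f z)) contour_integrable_on linepath p q"
proof -
  define g where "g x t = f (linepath p q t) x * (q - p)" for x t
  have cg: "continuous_on ({a..b} \<times> {0..1}) (\<lambda>(x, t). g x t)"
  proof -
    have "continuous_on ({a..b} \<times> {0..1}) ((\<lambda>(z, x). f z x) \<circ> (\<lambda>u. (linepath p q (snd u), fst u)))"
      by (rule continuous_on_compose[OF _ continuous_on_subset[OF cont]])
        (auto simp: linepath_def intro!: continuous_intros, auto simp: closed_segment_def)
    then have "continuous_on ({a..b} \<times> {0..1}) (\<lambda>u. f (linepath p q (snd u)) (fst u) * (q - p))"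
      by (intro continuous_intros) (simp add: o_def)
    then show ?thesis by (simp add: g_def case_prod_beta)
  qed
  have c1: "continuous_on (cbox a b) (\<lambda>x. integral (cbox 0 1) (g x))"
    by (rule integral_continuous_on_param) (use cg in simp)
  have c2: "continuous_on (cbox 0 1) (\<lambda>t. integral (cbox a b) (\<lambda>x. g x t))"
  proof (rule integral_continuous_on_param)
    have "continuous_on ({0..1} \<times> {a..b}) ((\<lambda>(x, t). g x t) \<circ> prod.swap)"
      by (rule continuous_on_compose[OF continuous_on_swap])
         (use cg in \<open>simp add: product_swap\<close>)
    then show "continuous_on (cbox 0 1 \<times> cbox a b) (\<lambda>(t, x). g x t)"
      by (simp add: o_def case_prod_beta)
  qed
  have "integral (cbox a b) (\<lambda>x. integral (cbox 0 1) (g x)) = integral (cbox 0 1) (\<lambda>t. integral (cbox a b) (\<lambda>x. g x t))"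
    by (rule integral_swap_continuous) (use cg in \<open>simp add: cbox_Pair_eq\<close>)
  moreover have "integral (cbox a b) (\<lambda>x. g x t) = integral {a..b} (f (linepath p q t)) * (q - p)" for t
    by (simp add: g_def)
  moreover have "integral (cbox 0 1) (g x) = contour_integral (linepath p q) (\<lambda>z. f z x)" for x
    by (simp add: contour_integral_integral g_def[abs_def])
  moreover have "(\<lambda>x. integral (cbox 0 1) (g x)) integrable_on {a..b}"
    using integrable_continuous[OF c1] by simp
  moreover have "(\<lambda>t. integral (cbox a b) (\<lambda>x. g x t)) integrable_on {0..1}"
    using integrable_continuous[OF c2] by simp
  ultimately show "((\<lambda>x. contour_integral (linepath p q) (\<lambda>z. f z x)) has_integral
            contour_integral (linepath p q) (\<lambda>z. integral {a..b} (f z))) {a..b}"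
    and "(\<lambda>z. integral {a..b} (f z)) contour_integrable_on linepath p q"
    by (simp_all add: contour_integral_integral has_integral_iff contour_integrable_on)
qed

lemma contour_integral_rectpath:
  assumes "f contour_integrable_on (linepath p (Complex (Re q) (Im p)))"
        "f contour_integrable_on (linepath (Complex (Re q) (Im p)) q)"
        "f contour_integrable_on (linepath q (Complex (Re p) (Im q)))"
        "f contour_integrable_on (linepath (Complex (Re p) (Im q)) p)"
  shows "contour_integral (rectpath p q) f =
      contour_integral (linepath p (Complex (Re q) (Im p))) f
    + contour_integral (linepath (Complex (Re q) (Im p)) q) f
    + contour_integral (linepath q (Complex (Re p) (Im q))) f
    + contour_integral (linepath (Complex (Re p) (Im q)) p) f"
  using assms by (simp add: rectpath_def Let_def add.assoc valid_path_join)

lemma integral_contour_integral_rectpath_swap: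
  fixes f :: "complex \<Rightarrow> real \<Rightarrow> complex"
  assumes cont: "continuous_on (path_image (rectpath p q) \<times> {a..b}) (\<lambda>(z, x). f z x)"
  shows "((\<lambda>x. contour_integral (rectpath p q) (\<lambda>z. f z x)) has_integral
            contour_integral (rectpath p q) (\<lambda>z. integral {a..b} (f z))) {a..b}"
    and "(\<lambda>z. integral {a..b} (f z)) contour_integrable_on (rectpath p q)"
proof -
  define p' q' where "p' = Complex (Re q) (Im p)" and "q' = Complex (Re p) (Im q)"
  have sub: "closed_segment p p' \<subseteq> path_image (rectpath p q)"
            "closed_segment p' q \<subseteq> path_image (rectpath p q)"
            "closed_segment q q' \<subseteq> path_image (rectpath p q)"
            "closed_segment q' p \<subseteq> path_image (rectpath p q)"
    by (auto simp: rectpath_def Let_def path_image_join p'_def q'_def)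
  have c: "continuous_on (closed_segment u v \<times> {a..b}) (\<lambda>(z, x). f z x)"
    if "closed_segment u v \<subseteq> path_image (rectpath p q)" for u v
    using that by (intro continuous_on_subset[OF cont]) auto
  note sw = integral_contour_integral_linepath_swap[OF c]
  have fi: "(\<lambda>z. f z x) contour_integrable_on linepath u v"
    if "closed_segment u v \<subseteq> path_image (rectpath p q)" "x \<in> {a..b}" for u v x
  proof (rule contour_integrable_continuous_linepath)
    have "continuous_on (closed_segment u v) ((\<lambda>(z, x). f z x) \<circ> (\<lambda>z. (z, x)))"
      by (rule continuous_on_compose[OF _ continuous_on_subset[OF c[OF that(1)]]])
         (use that in \<open>auto intro!: continuous_intros\<close>)
    then show "continuous_on (closed_segment u v) (\<lambda>z. f z x)" by (simp add: o_def)
  qed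
  show "(\<lambda>z. integral {a..b} (f z)) contour_integrable_on (rectpath p q)"
    using sub sw(2) by (simp add: rectpath_def Let_def valid_path_join p'_def q'_def)
  have 1: "contour_integral (rectpath p q) (\<lambda>z. integral {a..b} (f z)) =
     contour_integral (linepath p p') (\<lambda>z. integral {a..b} (f z))
   + contour_integral (linepath p' q) (\<lambda>z. integral {a..b} (f z))
   + contour_integral (linepath q q') (\<lambda>z. integral {a..b} (f z))
   + contour_integral (linepath q' p) (\<lambda>z. integral {a..b} (f z))"
    unfolding p'_def q'_def
    by (rule contour_integral_rectpath; fold p'_def q'_def; rule sw(2)[OF sub(1)] sw(2)[OF sub(2)] sw(2)[OF sub(3)] sw(2)[OF sub(4)])
  have 2: "contour_integral (rectpath p q) (\<lambda>z. f z x) =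
     contour_integral (linepath p p') (\<lambda>z. f z x)
   + contour_integral (linepath p' q) (\<lambda>z. f z x)
   + contour_integral (linepath q q') (\<lambda>z. f z x)
   + contour_integral (linepath q' p) (\<lambda>z. f z x)" if "x \<in> {a..b}" for x
    unfolding p'_def q'_def
    by (rule contour_integral_rectpath; fold p'_def q'_def; rule fi[OF sub(1) that] fi[OF sub(2) that] fi[OF sub(3) that] fi[OF sub(4) that])
  show "((\<lambda>x. contour_integral (rectpath p q) (\<lambda>z. f z x)) has_integral
            contour_integral (rectpath p q) (\<lambda>z. integral {a..b} (f z))) {a..b}"
    unfolding 1
    by (rule has_integral_eq[OF 2[symmetric]], assumption, intro has_integral_add sw(1) sub)
qed

section \<open>Residues of the sinc kernel\<close>

lemma sin_scaled_eq_0_iff: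
  fixes z :: complex
  assumes "h > 0"
  shows "sin (of_real (pi / h) * z) = 0 \<longleftrightarrow> (\<exists>k::int. z = of_real (real_of_int k * h))"
proof -
  have "sin (of_real (pi / h) * z) = 0 \<longleftrightarrow> (\<exists>k::int. of_real (pi / h) * z = of_real (real_of_int k * pi))"
    by (rule sin_eq_0)
  also have "\<dots> \<longleftrightarrow> (\<exists>k::int. z = of_real (real_of_int k * h))"
    using assms by (intro ex_cong1) (auto simp: field_simps)
  finally show ?thesis .
qed

text \<open>The pole is simple, so the residue divides by the derivative (pi/h) cos(pi k) of the
  sine. As cos(pi k) is 1 or -1, it is its own reciprocal and appears in the numerator.\<close>

lemma residue_at_node:
  fixes F :: "complex \<Rightarrow> complex" and k :: int
  assumes S: "open S" and F: "F holomorphic_on S" and h: "h > 0"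
    and k: "of_real (real_of_int k * h) \<in> S" and x: "x \<noteq> of_real (real_of_int k * h)"
  shows "residue (\<lambda>z. F z / ((z - x) * sin (of_real (pi / h) * z))) (of_real (real_of_int k * h))
       = F (of_real (real_of_int k * h)) / (of_real (real_of_int k * h) - x) * of_real (h * cos (pi * real_of_int k) / pi)"
proof -
  define c where "c = complex_of_real (real_of_int k * h)"
  \<comment> \<open>The radius is the distance between nodes, so kh is the only zero of the sine in
    the ball; the other pole x is removed by hand.\<close>
  define T where "T = S \<inter> ball c h - {x}"
  have ck2: "(cos (pi * real_of_int k))\<^sup>2 = 1"
    by (simp add: cos_npi_int)
  have scal: "complex_of_real (pi / h) * c = of_real (pi * real_of_int k)"
    using h by (simp add: c_def)
  have sc: "sin (complex_of_real (pi / h) * c) = 0"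
    using sin_scaled_eq_0_iff[OF h, of c] by (auto simp: c_def)
  have op: "open T" and cT: "c \<in> T"
    using S h k x by (auto simp: T_def c_def)
  have nz: "sin (of_real (pi / h) * z) \<noteq> 0" if "z \<in> T - {c}" for z
  proof
    assume "sin (of_real (pi / h) * z) = 0"
    then obtain j :: int where j: "z = of_real (real_of_int j * h)"
      using sin_scaled_eq_0_iff[OF h] by blast
    have "dist c z = \<bar>real_of_int (k - j)\<bar> * h"
      using h by (simp add: j c_def dist_norm left_diff_distrib[symmetric] norm_mult abs_mult flip: of_real_diff of_real_mult)
    moreover have "dist c z < h" using that by (simp add: T_def)
    ultimately have "\<bar>real_of_int (k - j)\<bar> < 1" using h by simp
    then have "k = j" by linarith
    then show False using that j by (simp add: c_def)
  qed
  have holo: "(\<lambda>z. F z / ((z - x) * sin (of_real (pi / h) * z))) holomorphic_on (T - {c})"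
    using nz by (intro holomorphic_intros holomorphic_on_subset[OF F]) (auto simp: T_def)
  have "((\<lambda>z. sin (of_real (pi / h) * z)) has_field_derivative
          cos (of_real (pi / h) * c) * of_real (pi / h)) (at c)"
    using h by (auto intro!: derivative_eq_intros)
  then have lim: "((\<lambda>z. sin (of_real (pi / h) * z) / (z - c)) \<longlongrightarrow> cos (of_real (pi / h) * c) * of_real (pi / h)) (at c)"
    by (simp only: has_field_derivative_iff sc diff_0_right)
  have ceq: "cos (of_real (pi / h) * c) * of_real (pi / h) = complex_of_real (cos (pi * real_of_int k) * pi / h)"
    unfolding scal cos_of_real by simp
  have ne: "complex_of_real (cos (pi * real_of_int k) * pi / h) \<noteq> 0"
    using ck2 h by auto
  have "isCont F c"
    using holomorphic_on_imp_continuous_on[OF F] S k by (metis c_def continuous_on_eq_continuous_at)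
  then have "((\<lambda>z. F z / (z - x)) \<longlongrightarrow> F c / (c - x)) (at c)"
    using x by (intro tendsto_intros) (auto simp: c_def isCont_def)
  from tendsto_divide[OF this lim[unfolded ceq] ne]
  have "((\<lambda>z. (F z / (z - x)) / (sin (of_real (pi / h) * z) / (z - c)))
      \<longlongrightarrow> (F c / (c - x)) / of_real (cos (pi * real_of_int k) * pi / h)) (at c)" .
  also have "(F c / (c - x)) / of_real (cos (pi * real_of_int k) * pi / h)
           = F c / (c - x) * of_real (h * cos (pi * real_of_int k) / pi)"
  proof -
    have "1 / (cos (pi * real_of_int k) * pi / h) = h * cos (pi * real_of_int k) / pi"
      using ck2 h by (auto simp: field_simps power2_eq_square)
    then have "1 / complex_of_real (cos (pi * real_of_int k) * pi / h) = of_real (h * cos (pi * real_of_int k) / pi)"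
      by (metis of_real_1 of_real_divide)
    then show ?thesis by (simp only: divide_inverse mult_1_left)
  qed
  finally have "((\<lambda>z. F z / ((z - x) * sin (of_real (pi / h) * z)) * (z - c))
      \<longlongrightarrow> F c / (c - x) * of_real (h * cos (pi * real_of_int k) / pi)) (at c)"
    by (simp add: field_simps)
  from residue_simple'[OF op cT holo this] show ?thesis by (simp add: c_def)
qed

text \<open>The residue at x yields F(x), those at the nodes yield the sinc terms. The half-integer
  in R puts the vertical sides midway between nodes, and x avoids the nodes so that every pole is
  simple.\<close>

lemma sinc_series_remainder:
  fixes F :: "complex \<Rightarrow> complex" and m :: nat
  assumes F: "F holomorphic_on strip d" and h: "h > 0" and \<delta>: "0 < \<delta>" "\<delta> < d"
    and R: "R = (real m + 1 / 2) * h" and x: "\<bar>x\<bar> < R" "\<And>k::int. x \<noteq> real_of_int k * h"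
  shows "F (of_real x) - (\<Sum>k\<in>{-int m..int m}. F (of_real (real_of_int k * h))
            * of_real (sinc (pi * (x / h - real_of_int k))))
      = of_real (sin (pi * x / h)) / (2 * of_real pi * \<i>) *
          contour_integral (rectpath (Complex (-R) (-\<delta>)) (Complex R \<delta>))
             (\<lambda>z. F z / ((z - of_real x) * sin (of_real (pi / h) * z)))"
    and "(\<lambda>z. F z / ((z - of_real x) * sin (of_real (pi / h) * z)))
           contour_integrable_on rectpath (Complex (-R) (-\<delta>)) (Complex R \<delta>)"
proof -
  define g where "g = rectpath (Complex (-R) (-\<delta>)) (Complex R \<delta>)"
  define G where "G = (\<lambda>z. F z / ((z - of_real x) * sin (of_real (pi / h) * z)))"
  \<comment> \<open>The residue theorem wants a connected open set with finitely many singularities.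
    The points (m+1)h and -(m+1)h lie on the boundary of this box, so it contains exactly the nodes
    with |k| <= m.\<close>
  define S where "S = box (Complex (- ((real m + 1) * h)) (-d)) (Complex ((real m + 1) * h) d)"
  define c where "c k = complex_of_real (real_of_int k * h)" for k :: int
  have R0: "R > 0" "R < (real m + 1) * h" unfolding R using h by (auto intro!: mult_pos_pos)
  have opS: "open S" "convex S" "connected S"
    by (auto simp: S_def convex_connected)
  have S_strip: "S \<subseteq> strip d" by (auto simp: S_def strip_def in_box_complex_iff)
  have FS: "F holomorphic_on S" by (rule holomorphic_on_subset[OF F S_strip])
  have cS: "c k \<in> S \<longleftrightarrow> k \<in> {-int m..int m}" for k
  proof -
    have "c k \<in> S \<longleftrightarrow> - ((real m + 1) * h) < real_of_int k * h \<and> real_of_int k * h < (real m + 1) * h"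
      using \<delta> by (auto simp: S_def in_box_complex_iff c_def)
    also have "\<dots> \<longleftrightarrow> - (real m + 1) < real_of_int k \<and> real_of_int k < real m + 1"
      using h by (simp only: minus_mult_left mult_less_cancel_right_pos)
    also have "\<dots> \<longleftrightarrow> k \<in> {-int m..int m}" by auto
    finally show ?thesis .
  qed
  have cbox: "c k \<in> box (Complex (-R) (-\<delta>)) (Complex R \<delta>)" if "k \<in> {-int m..int m}" for k
  proof -
    have "- real m \<le> real_of_int k" "real_of_int k \<le> real m" using that by auto
    then have "- real m * h \<le> real_of_int k * h" "real_of_int k * h \<le> real m * h"
      using h mult_right_mono[of "- real m" "real_of_int k" h] mult_right_mono[of "real_of_int k" "real m" h] by simp_all
    moreover have "real m * h < R" using h by (simp add: R field_simps)
    ultimately show ?thesis using \<delta> by (auto simp: in_box_complex_iff c_def)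
  qed
  have xbox: "of_real x \<in> box (Complex (-R) (-\<delta>)) (Complex R \<delta>)"
    using x \<delta> by (auto simp: in_box_complex_iff)
  have injc: "inj c" using h by (auto simp: inj_on_def c_def)
  have xc: "of_real x \<noteq> c k" for k
    using x(2)[of k] unfolding c_def of_real_eq_iff by simp
  define pts where "pts = insert (of_real x) (c ` {-int m..int m})"
  have fin: "finite pts" by (simp add: pts_def)
  have nz: "sin (of_real (pi / h) * z) \<noteq> 0" if "z \<in> S" "z \<notin> c ` {-int m..int m}" for z
    using that cS sin_scaled_eq_0_iff[OF h, of z] by (auto simp: c_def)
  have holG: "G holomorphic_on (S - pts)"
    unfolding G_def using nz by (intro holomorphic_intros holomorphic_on_subset[OF FS]) (auto simp: pts_def)
  have im: "path_image g = {z. Re z \<in> {-R, R} \<and> Im z \<in> {-\<delta>..\<delta>}} \<union> {z. Im z \<in> {-\<delta>, \<delta>} \<and> Re z \<in> {-R..R}}"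
    unfolding g_def using R0 \<delta> by (subst path_image_rectpath) auto
  have imS: "path_image g \<subseteq> S"
    using im R0 \<delta> by (auto simp: S_def in_box_complex_iff)
  have "path_image g \<inter> box (Complex (-R) (-\<delta>)) (Complex R \<delta>) = {}"
    unfolding g_def using R0 \<delta> by (intro path_image_rectpath_inter_box) auto
  then have impts: "path_image g \<inter> pts = {}"
    using cbox xbox by (auto simp: pts_def)
  have "G contour_integrable_on g"
    by (rule contour_integrable_holomorphic_simple[OF holG])
      (use opS fin imS impts in \<open>auto simp: g_def intro!: open_Diff finite_imp_closed\<close>)
  then show "(\<lambda>z. F z / ((z - of_real x) * sin (of_real (pi / h) * z)))
           contour_integrable_on rectpath (Complex (-R) (-\<delta>)) (Complex R \<delta>)"
    by (simp only: g_def G_def)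
  have "contour_integral g G = 2 * pi * \<i> * (\<Sum>p\<in>pts. winding_number g p * residue G p)"
  proof (rule Residue_theorem[OF opS(1,3) fin holG])
    show "valid_path g" "pathfinish g = pathstart g" by (auto simp: g_def)
    show "path_image g \<subseteq> S - pts" using imS impts by blast
    show "\<forall>z. z \<notin> S \<longrightarrow> winding_number g z = 0"
      using imS opS by (auto intro!: winding_number_zero_outside[where s = S] simp: g_def)
  qed
  also have "(\<Sum>p\<in>pts. winding_number g p * residue G p) = (\<Sum>p\<in>pts. residue G p)"
  proof (rule sum.cong[OF refl])
    fix p assume "p \<in> pts"
    then have "winding_number g p = 1"
      unfolding g_def using cbox xbox by (intro winding_number_rectpath) (auto simp: pts_def)
    then show "winding_number g p * residue G p = residue G p" by simp
  qed
  also have "\<dots> = residue G (of_real x) + (\<Sum>k\<in>{-int m..int m}. residue G (c k))"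
  proof -
    have "of_real x \<notin> c ` {-int m..int m}" using xc by auto
    then show ?thesis unfolding pts_def
      by (simp add: sum.reindex[OF inj_on_subset[OF injc]])
  qed
  also have "residue G (of_real x) = F (of_real x) / of_real (sin (pi * x / h))"
  proof -
    have op: "open (S - c ` {-int m..int m})"
      using opS by (intro open_Diff finite_imp_closed) auto
    have xS: "of_real x \<in> S - c ` {-int m..int m}"
      using x R0 \<delta> xc by (auto simp: S_def in_box_complex_iff)
    have "(\<lambda>z. F z / sin (of_real (pi / h) * z)) holomorphic_on (S - c ` {-int m..int m})"
      using nz by (intro holomorphic_intros holomorphic_on_subset[OF FS]) auto
    from residue_simple[OF op xS this] show ?thesis
      by (simp add: G_def mult.commute flip: sin_of_real)
  qed
  also have "(\<Sum>k\<in>{-int m..int m}. residue G (c k))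
     = (\<Sum>k\<in>{-int m..int m}. F (c k) / (c k - of_real x) * of_real (h * cos (pi * real_of_int k) / pi))"
  proof (rule sum.cong[OF refl])
    fix k assume "k \<in> {-int m..int m}"
    then have "c k \<in> S" using cS by simp
    then show "residue G (c k) = F (c k) / (c k - of_real x) * of_real (h * cos (pi * real_of_int k) / pi)"
      unfolding G_def c_def using xc[of k] by (intro residue_at_node[OF opS(1) FS h]) (auto simp: c_def)
  qed
  finally have CI: "contour_integral g G = 2 * pi * \<i> *
     (F (of_real x) / of_real (sin (pi * x / h)) +
      (\<Sum>k\<in>{-int m..int m}. F (c k) / (c k - of_real x) * of_real (h * cos (pi * real_of_int k) / pi)))" .
  have sx: "sin (pi * x / h) \<noteq> 0"
  proof
    assume "sin (pi * x / h) = 0"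
    then have "sin (of_real (pi / h) * complex_of_real x) = 0"
      using sin_of_real[of "pi * x / h", where 'a = complex] by simp
    then show False using sin_scaled_eq_0_iff[OF h, of "of_real x"] xc by (auto simp: c_def)
  qed
  \<comment> \<open>By the addition theorem sin(pi x/h) cos(pi k) is the shifted sine. The minus
    sign arises because the residue has kh - x where the sinc function has x - kh.\<close>
  have term_eq: "of_real (sin (pi * x / h)) * (F (c k) / (c k - of_real x) * of_real (h * cos (pi * real_of_int k) / pi))
       = - (F (c k) * of_real (sinc (pi * (x / h - real_of_int k))))" for k
  proof -
    have ne: "x / h - real_of_int k \<noteq> 0" "real_of_int k * h - x \<noteq> 0" using x(2)[of k] h by (auto simp: field_simps)
    have "pi * (x / h - real_of_int k) = pi * x / h - pi * real_of_int k" by (simp add: algebra_simps)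
    then have "sin (pi * (x / h - real_of_int k)) = sin (pi * x / h) * cos (pi * real_of_int k)"
      by (simp add: sin_diff sin_npi_int)
    then have "sinc (pi * (x / h - real_of_int k)) = sin (pi * x / h) * cos (pi * real_of_int k) / (pi * (x / h - real_of_int k))"
      using ne by simp
    also have "\<dots> = - (sin (pi * x / h) * (1 / (real_of_int k * h - x)) * (h * cos (pi * real_of_int k) / pi))"
      using ne h by (simp add: divide_simps) (simp add: algebra_simps)
    finally have "complex_of_real (sinc (pi * (x / h - real_of_int k))) =
       - (of_real (sin (pi * x / h)) * (1 / (c k - of_real x)) * of_real (h * cos (pi * real_of_int k) / pi))"
      by (simp add: c_def)
    then show ?thesis by simp
  qed
  have "of_real (sin (pi * x / h)) / (2 * of_real pi * \<i>) * contour_integral g G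
     = of_real (sin (pi * x / h)) * (F (of_real x) / of_real (sin (pi * x / h)) +
      (\<Sum>k\<in>{-int m..int m}. F (c k) / (c k - of_real x) * of_real (h * cos (pi * real_of_int k) / pi)))"
  proof -
    have "u / (2 * of_real pi * \<i>) * (2 * pi * \<i> * v) = u * v" for u v :: complex
      by (simp add: mult.left_commute[of u \<i>])
    then show ?thesis unfolding CI .
  qed
  also have "\<dots> = F (of_real x) - (\<Sum>k\<in>{-int m..int m}. F (c k) * of_real (sinc (pi * (x / h - real_of_int k))))"
    unfolding distrib_left sum_distrib_left term_eq using sx by (simp add: sum_negf)
  finally show "F (of_real x) - (\<Sum>k\<in>{-int m..int m}. F (of_real (real_of_int k * h))
            * of_real (sinc (pi * (x / h - real_of_int k))))
      = of_real (sin (pi * x / h)) / (2 * of_real pi * \<i>) *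
          contour_integral (rectpath (Complex (-R) (-\<delta>)) (Complex R \<delta>))
             (\<lambda>z. F z / ((z - of_real x) * sin (of_real (pi / h) * z)))"
    by (simp only: g_def G_def c_def)
qed

text \<open>Both end points lie strictly inside the rectangle, so z - x never vanishes on the
  contour and the integrand is jointly continuous, as the exchange of integrals requires.\<close>

lemma integral_sinc_series_remainder:
  fixes F :: "complex \<Rightarrow> complex" and m :: nat
  assumes F: "F holomorphic_on strip d" and h: "h > 0" and \<delta>: "0 < \<delta>" "\<delta> < d"
    and R: "R = (real m + 1 / 2) * h" and ab: "- R < a" "a \<le> b" "b < R"
  defines "\<Phi> \<equiv> (\<lambda>z. F z / sin (of_real (pi / h) * z) *
              integral {a..b} (\<lambda>x. of_real (sin (pi * x / h)) / (z - of_real x)))"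
  shows "integral {a..b} (\<lambda>x. F (of_real x)) - (\<Sum>k\<in>{-int m..int m}. F (of_real (real_of_int k * h))
            * of_real (J k h b - J k h a))
      = 1 / (2 * of_real pi * \<i>) * contour_integral (rectpath (Complex (-R) (-\<delta>)) (Complex R \<delta>)) \<Phi>"
    and "\<Phi> contour_integrable_on (rectpath (Complex (-R) (-\<delta>)) (Complex R \<delta>))"
proof -
  define p q where "p = Complex (-R) (-\<delta>)" and "q = Complex R \<delta>"
  define f where "f z x = F z / sin (of_real (pi / h) * z) * (of_real (sin (pi * x / h)) / (z - of_real x))" for z x
  have R0: "R > 0" using h by (simp add: R add_pos_pos)
  have im: "path_image (rectpath p q) = {z. Re z \<in> {-R, R} \<and> Im z \<in> {-\<delta>..\<delta>}} \<union> {z. Im z \<in> {-\<delta>, \<delta>} \<and> Re z \<in> {-R..R}}"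
    unfolding p_def q_def using R0 \<delta> by (subst path_image_rectpath) auto
  have nz: "sin (of_real (pi / h) * z) \<noteq> 0" if "z \<in> path_image (rectpath p q)" for z
  proof
    assume "sin (of_real (pi / h) * z) = 0"
    then obtain k :: int where k: "z = of_real (real_of_int k * h)"
      using sin_scaled_eq_0_iff[OF h] by blast
    then have "real_of_int k * h = R \<or> real_of_int k * h = -R"
      using that \<delta> by (auto simp: im)
    \<comment> \<open>A zero of the sine on the contour would be real, hence R or -R, and doubling
      equates an even with an odd integer.\<close>
    then have "real_of_int k = real m + 1/2 \<or> real_of_int k = - (real m + 1/2)"
      using h unfolding R by (metis mult_cancel_right mult_minus_left order_less_irrefl)
    then have "real_of_int (2 * k) = real_of_int (2 * int m + 1) \<or> real_of_int (2 * k) = real_of_int (- (2 * int m + 1))"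
      by auto
    then have "2 * k = 2 * int m + 1 \<or> 2 * k = - (2 * int m + 1)"
      unfolding of_int_eq_iff .
    then show False by presburger
  qed
  have contF: "continuous_on (path_image (rectpath p q)) F"
    using \<delta> by (intro continuous_on_subset[OF holomorphic_on_imp_continuous_on[OF F]]) (auto simp: im strip_def)
  have zx: "z \<noteq> of_real x" if "z \<in> path_image (rectpath p q)" "x \<in> {a..b}" for z x
    using that ab \<delta> by (auto simp: im)
  have cont: "continuous_on (path_image (rectpath p q) \<times> {a..b}) (\<lambda>(z, x). f z x)"
  proof -
    have "continuous_on (path_image (rectpath p q) \<times> {a..b}) (\<lambda>u. F (fst u))"
      by (rule continuous_on_compose2[OF contF]) (auto intro!: continuous_intros)
    then have "continuous_on (path_image (rectpath p q) \<times> {a..b}) (\<lambda>u. f (fst u) (snd u))"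
      unfolding f_def using nz zx h by (intro continuous_intros) auto
    then show ?thesis by (simp add: case_prod_beta)
  qed
  have \<Phi>: "\<Phi> = (\<lambda>z. integral {a..b} (f z))"
    unfolding \<Phi>_def f_def by (intro ext integral_mult_right[symmetric])
  note sw = integral_contour_integral_rectpath_swap[OF cont, folded \<Phi>]
  show "\<Phi> contour_integrable_on (rectpath (Complex (-R) (-\<delta>)) (Complex R \<delta>))"
    using sw(2) by (simp add: p_def q_def)
  define L where "L x = F (of_real x) - (\<Sum>k\<in>{-int m..int m}. F (of_real (real_of_int k * h))
            * of_real (sinc (pi * (x / h - real_of_int k))))" for x
  have iF: "((\<lambda>x. F (of_real x)) has_integral integral {a..b} (\<lambda>x. F (of_real x))) {a..b}"
  proof (intro integrable_integral integrable_continuous_real)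
    show "continuous_on {a..b} (\<lambda>x. F (of_real x))"
      by (rule continuous_on_compose2[OF holomorphic_on_imp_continuous_on[OF F]])
         (use \<delta> in \<open>auto intro!: continuous_intros simp: strip_def\<close>)
  qed
  have L1: "(L has_integral (integral {a..b} (\<lambda>x. F (of_real x)) - (\<Sum>k\<in>{-int m..int m}. F (of_real (real_of_int k * h))
            * of_real (J k h b - J k h a)))) {a..b}"
    unfolding L_def
    by (intro has_integral_diff iF has_integral_sum has_integral_mult_right has_integral_of_real
          has_integral_sinc_shift h ab) auto
  \<comment> \<open>The pointwise identity is available only off the nodes. Finitely many of them
    meet the interval, so the integral ignores them.\<close>
  define B where "B = (\<lambda>k. real_of_int k * h) ` {-int m..int m}"
  have finB: "finite B" by (simp add: B_def)
  have L2: "1 / (2 * of_real pi * \<i>) * contour_integral (rectpath p q) (\<lambda>z. f z x) = L x" if "x \<in> {a..b} - B" for x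
  proof -
    have xR: "\<bar>x\<bar> < R" using that ab by auto
    have xk: "x \<noteq> real_of_int k * h" for k :: int
    proof
      assume xk: "x = real_of_int k * h"
      have "\<bar>real_of_int k\<bar> * h < (real m + 1/2) * h" using xR h by (simp add: xk R abs_mult)
      then have "\<bar>real_of_int k\<bar> < real m + 1/2" using h by simp
      then have "k \<in> {-int m..int m}" by auto
      then show False using that xk by (auto simp: B_def)
    qed
    have "contour_integral (rectpath p q) (\<lambda>z. f z x)
        = of_real (sin (pi * x / h)) * contour_integral (rectpath p q) (\<lambda>z. F z / ((z - of_real x) * sin (of_real (pi / h) * z)))"
    proof -
      have "(\<lambda>z. f z x) = (\<lambda>z. of_real (sin (pi * x / h)) * (F z / ((z - of_real x) * sin (of_real (pi / h) * z))))"
        by (auto simp: f_def mult.commute)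
      moreover have "(\<lambda>z. F z / ((z - of_real x) * sin (of_real (pi / h) * z))) contour_integrable_on (rectpath p q)"
        using sinc_series_remainder(2)[OF F h \<delta> R xR xk] by (simp only: p_def q_def)
      ultimately show ?thesis by (simp only: contour_integral_lmul)
    qed
    then show ?thesis
      using sinc_series_remainder(1)[OF F h \<delta> R xR xk] by (simp add: L_def p_def q_def)
  qed
  have "((\<lambda>x. 1 / (2 * of_real pi * \<i>) * contour_integral (rectpath p q) (\<lambda>z. f z x)) has_integral
           1 / (2 * of_real pi * \<i>) * contour_integral (rectpath p q) \<Phi>) {a..b}"
    by (intro has_integral_mult_right sw(1))
  then have "(L has_integral 1 / (2 * of_real pi * \<i>) * contour_integral (rectpath p q) \<Phi>) {a..b}"
    by (rule has_integral_spike_finite[OF finB, rotated]) (use L2 in auto)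
  from has_integral_unique[OF L1 this] show "integral {a..b} (\<lambda>x. F (of_real x)) - (\<Sum>k\<in>{-int m..int m}. F (of_real (real_of_int k * h))
            * of_real (J k h b - J k h a))
      = 1 / (2 * of_real pi * \<i>) * contour_integral (rectpath (Complex (-R) (-\<delta>)) (Complex R \<delta>)) \<Phi>"
    by (simp add: p_def q_def)
qed

subsection \<open>Discretization error\<close>

text \<open>Length times maximum would grow with the rectangle. A pointwise majorant
  \<open>w\<close> keeps the exponential decay along the side, so the bound survives as the
  rectangle widens.\<close>

lemma norm_contour_integral_horizontal_le:
  assumes f: "f contour_integrable_on linepath (Complex a c) (Complex b c)" and ab: "a < b"
    and w: "(w has_integral I) {a..b}" and le: "\<And>t. t \<in> {a..b} \<Longrightarrow> cmod (f (Complex t c)) \<le> w t"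
  shows "cmod (contour_integral (linepath (Complex a c) (Complex b c)) f) \<le> I"
proof -
  have lp: "linepath (Complex a c) (Complex b c) t = Complex ((b - a) * t + a) c" for t
    by (simp add: linepath_def complex_eq_iff algebra_simps)
  have 1: "((\<lambda>t. f (Complex ((b - a) * t + a) c) * of_real (b - a)) has_integral
             contour_integral (linepath (Complex a c) (Complex b c)) f) {0..1}"
  proof -
    have "Complex b c - Complex a c = of_real (b - a)" by (simp add: complex_eq_iff)
    then show ?thesis
      using has_contour_integral_integral[OF f] by (simp add: has_contour_integral_linepath lp)
  qed
  have "((\<lambda>t. w ((b - a) *\<^sub>R t + a)) has_integral (I /\<^sub>R (b - a) ^ DIM(real)))
          (cbox ((a - a) /\<^sub>R (b - a)) ((b - a) /\<^sub>R (b - a)))"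
    by (rule has_integral_affinity') (use w ab in auto)
  then have "((\<lambda>t. w ((b - a) * t + a)) has_integral (I / (b - a))) {0..1}"
    using ab by (simp add: field_simps)
  from has_integral_mult_left[OF this, of "b - a"]
  have 2: "((\<lambda>t. w ((b - a) * t + a) * (b - a)) has_integral I) {0..1}"
    using ab by simp
  have "cmod (integral {0..1} (\<lambda>t. f (Complex ((b - a) * t + a) c) * of_real (b - a)))
     \<le> integral {0..1} (\<lambda>t. w ((b - a) * t + a) * (b - a))"
  proof (rule integral_norm_bound_integral)
    show "(\<lambda>t. f (Complex ((b - a) * t + a) c) * complex_of_real (b - a)) integrable_on {0..1}"
         "(\<lambda>t. w ((b - a) * t + a) * (b - a)) integrable_on {0..1}"
      using 1 2 by (auto intro: has_integral_integrable)
    fix t :: real assume "t \<in> {0..1}"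
    then have "0 \<le> (b - a) * t" "(b - a) * t \<le> (b - a) * 1"
      using ab by (auto intro!: mult_left_mono)
    then have "cmod (f (Complex ((b - a) * t + a) c)) \<le> w ((b - a) * t + a)"
      by (intro le) auto
    moreover have "cmod (complex_of_real (b - a)) = b - a"
      using ab by (simp only: norm_of_real)
    ultimately show "cmod (f (Complex ((b - a) * t + a) c) * complex_of_real (b - a)) \<le> w ((b - a) * t + a) * (b - a)"
      using ab by (simp add: norm_mult mult_right_mono)
  qed
  then show ?thesis unfolding integral_unique[OF 1] integral_unique[OF 2] .
qed

text \<open>From |sin(x + iy)|^2 = sin^2 x + sinh^2 y. It serves the horizontal sides and is the
  source of sinh(pi d / h).\<close>

lemma sinh_abs_Im_le_norm_sin: "sinh \<bar>Im z\<bar> \<le> cmod (sin z)"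
proof (rule power2_le_imp_le)
  have "(exp (Im z) - exp (- Im z))\<^sup>2 = exp (2 * Im z) + inverse (exp (2 * Im z)) - 2"
    by (simp only: exp_minus exp_double) (simp add: field_simps power2_eq_square)
  moreover have "(sinh \<bar>Im z\<bar>)\<^sup>2 = ((exp (Im z) - exp (- Im z)) / 2)\<^sup>2"
    by (simp add: sinh_field_def power2_commute abs_if power_divide)
  ultimately show "(sinh \<bar>Im z\<bar>)\<^sup>2 \<le> (cmod (sin z))\<^sup>2"
    by (simp add: norm_sin_squared power_divide)
qed simp

text \<open>Here x = Re z is an odd multiple of pi/2, so |sin z| = cosh(Im z). This holds on the
  vertical sides because R/h is half an odd integer.\<close>

lemma one_le_norm_sin:
  assumes "cos (2 * Re z) = -1"
  shows "1 \<le> cmod (sin z)"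
proof (rule power2_le_imp_le)
  have "(exp (Im z) - exp (- Im z))\<^sup>2 = exp (2 * Im z) + inverse (exp (2 * Im z)) - 2"
    by (simp only: exp_minus exp_double) (simp add: field_simps power2_eq_square)
  moreover have "0 \<le> (exp (Im z) - exp (- Im z))\<^sup>2" by simp
  ultimately show "1\<^sup>2 \<le> (cmod (sin z))\<^sup>2"
    using assms by (simp add: norm_sin_squared)
qed simp

lemma integral_exp_envelope:
  fixes \<alpha> \<beta> R :: real
  assumes "\<alpha> > 0" "\<beta> > 0" "R > 0"
  shows "\<exists>I \<le> 1 / \<alpha> + 1 / \<beta>. ((\<lambda>t. if t \<le> 0 then exp (\<alpha> * t) else exp (- \<beta> * t)) has_integral I) {-R..R}"
proof (intro exI conjI)
  let ?w = "\<lambda>t. if t \<le> 0 then exp (\<alpha> * t) else exp (- \<beta> * t)"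
  have "((\<lambda>t. exp (\<alpha> * t)) has_integral (exp (\<alpha> * 0) / \<alpha> - exp (\<alpha> * (-R)) / \<alpha>)) {-R..0}"
    using assms by (intro fundamental_theorem_of_calculus)
      (auto intro!: derivative_eq_intros simp: has_real_derivative_iff_has_vector_derivative[symmetric])
  then have 1: "(?w has_integral (exp (\<alpha> * 0) / \<alpha> - exp (\<alpha> * (-R)) / \<alpha>)) {-R..0}"
    by (rule has_integral_eq[rotated]) auto
  have "((\<lambda>t. exp (- \<beta> * t)) has_integral ((- (exp (- \<beta> * R) / \<beta>)) - (- (exp (- \<beta> * 0) / \<beta>)))) {0..R}"
    using assms by (intro fundamental_theorem_of_calculus)
      (auto intro!: derivative_eq_intros simp: has_real_derivative_iff_has_vector_derivative[symmetric])
  then have 2: "(?w has_integral ((- (exp (- \<beta> * R) / \<beta>)) - (- (exp (- \<beta> * 0) / \<beta>)))) {0..R}"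
    by (rule has_integral_eq[rotated]) auto
  show "(?w has_integral ((exp (\<alpha> * 0) / \<alpha> - exp (\<alpha> * (-R)) / \<alpha>) + ((- (exp (- \<beta> * R) / \<beta>)) - (- (exp (- \<beta> * 0) / \<beta>))))) {-R..R}"
    by (rule has_integral_combine[OF _ _ 1 2]) (use assms in auto)
  show "(exp (\<alpha> * 0) / \<alpha> - exp (\<alpha> * (-R)) / \<alpha>) + ((- (exp (- \<beta> * R) / \<beta>)) - (- (exp (- \<beta> * 0) / \<beta>))) \<le> 1 / \<alpha> + 1 / \<beta>"
  proof -
    have "0 \<le> exp (\<alpha> * (-R)) / \<alpha>" "0 \<le> exp (- \<beta> * R) / \<beta>" using assms by auto
    then show ?thesis unfolding mult_zero_right exp_zero by linarith
  qed
qed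

text \<open>The first summand is the contribution of the horizontal sides and stays; the second
  belongs to the vertical sides and dies exponentially in R, provided that [a,b] keeps a distance R
  - r from them.\<close>

lemma sinc_indefinite_discretization_rectangle:
  fixes F :: "complex \<Rightarrow> complex" and m :: nat
  assumes F: "F holomorphic_on strip d" and h: "h > 0" and \<delta>: "0 < \<delta>" "\<delta> < d"
    and pos: "A \<ge> 0" "\<alpha> > 0" "\<beta> > 0"
    and bd: "\<And>z. z \<in> strip d \<Longrightarrow> cmod (F z) \<le> A * exp (\<alpha> * Re z)"
            "\<And>z. z \<in> strip d \<Longrightarrow> cmod (F z) \<le> A * exp (- \<beta> * Re z)"
    and R: "R = (real m + 1 / 2) * h" and ab: "a \<le> b" "\<bar>a\<bar> \<le> r" "\<bar>b\<bar> \<le> r" "r < R"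
  shows "cmod (integral {a..b} (\<lambda>x. F (of_real x)) - (\<Sum>k\<in>{-int m..int m}. F (of_real (real_of_int k * h))
            * of_real (J k h b - J k h a)))
      \<le> (A * (1 / \<alpha> + 1 / \<beta>) * (h / \<delta>) / sinh (pi * \<delta> / h)
           + A * exp (- min \<alpha> \<beta> * R) * ((b - a) / (R - r)) * (2 * \<delta>)) / pi"
proof -
  define I where "I z = integral {a..b} (\<lambda>x. of_real (sin (pi * x / h)) / (z - of_real x))" for z :: complex
  define \<Phi> where "\<Phi> = (\<lambda>z. F z / sin (of_real (pi / h) * z) * I z)"
  define p q where "p = Complex (-R) (-\<delta>)" and "q = Complex R \<delta>"
  define s where "s = sinh (pi * \<delta> / h)"
  have s0: "s > 0" using h \<delta> by (simp add: s_def)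
  have R0: "R > 0" using h by (simp add: R add_pos_pos)
  have ab': "-R < a" "b < R" using ab by auto
  note main = integral_sinc_series_remainder[OF F h \<delta> R ab'(1) ab(1) ab'(2), folded I_def, folded \<Phi>_def, folded p_def q_def]
  obtain I0 where I0: "I0 \<le> 1 / \<alpha> + 1 / \<beta>"
      "((\<lambda>t. if t \<le> 0 then exp (\<alpha> * t) else exp (- \<beta> * t)) has_integral I0) {-R..R}"
    using integral_exp_envelope[OF pos(2,3) R0] by blast
  have Fb: "cmod (F z) \<le> A * (if Re z \<le> 0 then exp (\<alpha> * Re z) else exp (- \<beta> * Re z))" if "z \<in> strip d" for z
    using bd[OF that] by auto
  define C where "C = A * (h / \<delta> / s)"
  have C0: "C \<ge> 0" using pos h \<delta> s0 by (simp add: C_def)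
  have hor: "cmod (\<Phi> z) \<le> C * (if Re z \<le> 0 then exp (\<alpha> * Re z) else exp (- \<beta> * Re z))"
    if "\<bar>Im z\<bar> = \<delta>" for z
  proof -
    have "cmod (I z) \<le> h / \<delta>"
      unfolding I_def by (rule norm_kernel_integral_le[OF h that \<delta>(1) ab(1)])
    moreover have "s \<le> cmod (sin (of_real (pi / h) * z))"
      using sinh_abs_Im_le_norm_sin[of "of_real (pi / h) * z"] that h by (simp add: s_def abs_mult)
    then have "1 / cmod (sin (of_real (pi / h) * z)) \<le> 1 / s"
      using s0 by (intro divide_left_mono) (auto intro!: mult_pos_pos)
    moreover have "cmod (F z) \<le> A * (if Re z \<le> 0 then exp (\<alpha> * Re z) else exp (- \<beta> * Re z))"
      using that \<delta> by (intro Fb) (simp add: strip_def)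
    ultimately have "cmod (F z) * (1 / cmod (sin (of_real (pi / h) * z))) * cmod (I z)
       \<le> A * (if Re z \<le> 0 then exp (\<alpha> * Re z) else exp (- \<beta> * Re z)) * (1 / s) * (h / \<delta>)"
      using pos s0 by (intro mult_mono mult_nonneg_nonneg) auto
    then show ?thesis
      by (simp add: \<Phi>_def C_def norm_mult norm_divide mult_ac)
  qed
  have hor_int: "cmod (contour_integral (linepath (Complex (-R) c) (Complex R c)) \<Phi>) \<le> C * (1 / \<alpha> + 1 / \<beta>)"
    if "\<bar>c\<bar> = \<delta>" "\<Phi> contour_integrable_on linepath (Complex (-R) c) (Complex R c)" for c
  proof -
    have "cmod (\<Phi> (Complex t c)) \<le> C * (if t \<le> 0 then exp (\<alpha> * t) else exp (- \<beta> * t))" for t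
      using hor[of "Complex t c", unfolded complex.sel, OF that(1)] .
    then have "cmod (contour_integral (linepath (Complex (-R) c) (Complex R c)) \<Phi>) \<le> C * I0"
      using R0 by (intro norm_contour_integral_horizontal_le[OF that(2) _ has_integral_mult_right[OF I0(2)]]) auto
    also have "\<dots> \<le> C * (1 / \<alpha> + 1 / \<beta>)" using C0 I0(1) by (rule mult_left_mono[rotated])
    finally show ?thesis .
  qed
  \<comment> \<open>On the vertical sides a crude bound of the kernel integral, length over
    distance, is enough: the decay of F outweighs the growth of b - a.\<close>
  define V where "V = A * exp (- min \<alpha> \<beta> * R) * ((b - a) / (R - r))"
  have V0: "V \<ge> 0" using pos ab by (simp add: V_def)
  have ver: "cmod (\<Phi> z) \<le> V" if "\<bar>Re z\<bar> = R" "\<bar>Im z\<bar> \<le> \<delta>" for z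
  proof -
    have zs: "z \<in> strip d" using that \<delta> by (simp add: strip_def)
    have "cmod (F z) \<le> A * exp (- min \<alpha> \<beta> * R)"
    proof (cases "Re z \<le> 0")
      case True
      then have "\<alpha> * Re z \<le> - min \<alpha> \<beta> * R"
        using that R0 mult_right_mono[of "min \<alpha> \<beta>" \<alpha> R] by (auto simp: abs_if)
      then show ?thesis using bd(1)[OF zs] pos by (meson exp_le_cancel_iff mult_left_mono order_trans)
    next
      case False
      then have "- \<beta> * Re z \<le> - min \<alpha> \<beta> * R"
        using that R0 mult_right_mono[of "min \<alpha> \<beta>" \<beta> R] by (auto simp: abs_if)
      then show ?thesis using bd(2)[OF zs] pos by (meson exp_le_cancel_iff mult_left_mono order_trans)
    qed
    moreover have "1 \<le> cmod (sin (of_real (pi / h) * z))"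
    proof (rule one_le_norm_sin)
      have "cos (2 * (pi / h * R)) = -1"
      proof -
        have "2 * (pi / h * R) = real (2 * m + 1) * pi" using h by (simp add: R field_simps)
        then show ?thesis by (simp only: cos_npi) simp
      qed
      moreover have "cos (2 * (pi / h * (- R))) = cos (2 * (pi / h * R))" by simp
      moreover have "Re z = R \<or> Re z = -R" using that by auto
      ultimately show "cos (2 * Re (of_real (pi / h) * z)) = -1"
        by (auto simp del: mult_minus_right)
    qed
    then have "1 / cmod (sin (of_real (pi / h) * z)) \<le> 1" by (simp add: divide_simps)
    moreover have "cmod (I z) \<le> (b - a) / (R - r)"
    proof -
      have "cmod (I z) \<le> integral {a..b} (\<lambda>x. 1 / (R - r))"
        unfolding I_def
      proof (rule integral_norm_bound_integral)
        have ne: "z \<noteq> of_real x" if "x \<in> {a..b}" for x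
          using that ab ab' \<open>\<bar>Re z\<bar> = R\<close> by auto
        then show "(\<lambda>x. complex_of_real (sin (pi * x / h)) / (z - complex_of_real x)) integrable_on {a..b}"
          using h by (intro integrable_continuous_real continuous_intros) auto
        fix x assume "x \<in> {a..b}"
        then have "R - r \<le> \<bar>Re (z - of_real x)\<bar>" using ab that by auto
        also have "\<dots> \<le> cmod (z - of_real x)" by (rule abs_Re_le_cmod)
        finally have "R - r \<le> cmod (z - of_real x)" .
        then show "cmod (complex_of_real (sin (pi * x / h)) / (z - complex_of_real x)) \<le> 1 / (R - r)"
          unfolding norm_divide using ab by (intro frac_le) auto
      qed auto
      then show ?thesis using ab by simp
    qed
    ultimately have "cmod (F z) * (1 / cmod (sin (of_real (pi / h) * z))) * cmod (I z)
        \<le> A * exp (- min \<alpha> \<beta> * R) * 1 * ((b - a) / (R - r))"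
      using pos ab by (intro mult_mono mult_nonneg_nonneg) auto
    then show ?thesis by (simp add: \<Phi>_def V_def norm_mult norm_divide)
  qed
  define p' q' where "p' = Complex R (-\<delta>)" and "q' = Complex (-R) \<delta>"
  have ci: "\<Phi> contour_integrable_on linepath p p'" "\<Phi> contour_integrable_on linepath p' q"
           "\<Phi> contour_integrable_on linepath q q'" "\<Phi> contour_integrable_on linepath q' p"
    using main(2) by (auto simp: rectpath_def Let_def p_def q_def p'_def q'_def valid_path_join)
  have e1: "cmod (contour_integral (linepath p p') \<Phi>) \<le> C * (1 / \<alpha> + 1 / \<beta>)"
    unfolding p_def p'_def by (rule hor_int) (use \<delta> ci(1) in \<open>auto simp: p_def p'_def\<close>)
  have e3: "cmod (contour_integral (linepath q q') \<Phi>) \<le> C * (1 / \<alpha> + 1 / \<beta>)"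
  proof -
    have "contour_integral (linepath q q') \<Phi> = - contour_integral (linepath q' q) \<Phi>"
      using contour_integral_reversepath[of "linepath q' q" \<Phi>] by simp
    moreover have "\<Phi> contour_integrable_on linepath q' q"
      using contour_integrable_reversepath[of "linepath q q'" \<Phi>] ci(3) by simp
    then have "cmod (contour_integral (linepath q' q) \<Phi>) \<le> C * (1 / \<alpha> + 1 / \<beta>)"
      unfolding q_def q'_def by (intro hor_int) (use \<delta> in auto)
    ultimately show ?thesis by simp
  qed
  have e2: "cmod (contour_integral (linepath p' q) \<Phi>) \<le> V * cmod (q - p')"
    by (rule contour_integral_bound_linepath[OF ci(2) V0 ver])
       (use R0 \<delta> in \<open>auto simp: p'_def q_def closed_segment_same_Re closed_segment_eq_real_ivl\<close>)
  have e4: "cmod (contour_integral (linepath q' p) \<Phi>) \<le> V * cmod (p - q')"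
    by (rule contour_integral_bound_linepath[OF ci(4) V0 ver])
       (use R0 \<delta> in \<open>auto simp: p_def q'_def closed_segment_same_Re closed_segment_eq_real_ivl\<close>)
  have len: "cmod (q - p') = 2 * \<delta>" "cmod (p - q') = 2 * \<delta>"
    using \<delta> by (auto simp: p_def q_def p'_def q'_def cmod_def real_sqrt_mult)
  have tri: "cmod (u + v + w + x) \<le> cmod u + cmod v + cmod w + cmod x" for u v w x
    using norm_triangle_ineq[of "u + v + w" x] norm_triangle_ineq[of "u + v" w] norm_triangle_ineq[of u v]
    by linarith
  have "contour_integral (rectpath p q) \<Phi> = contour_integral (linepath p p') \<Phi>
      + contour_integral (linepath p' q) \<Phi> + contour_integral (linepath q q') \<Phi> + contour_integral (linepath q' p) \<Phi>"
    using contour_integral_rectpath[of \<Phi> p q] ci R0 \<delta> by (simp add: p_def q_def p'_def q'_def)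
  then have "cmod (contour_integral (rectpath p q) \<Phi>) \<le> cmod (contour_integral (linepath p p') \<Phi>)
      + cmod (contour_integral (linepath p' q) \<Phi>) + cmod (contour_integral (linepath q q') \<Phi>) + cmod (contour_integral (linepath q' p) \<Phi>)"
    using tri by simp
  \<comment> \<open>Opposite sides obey the same bound; this 2 cancels the one in 2 pi i.\<close>
  also have "\<dots> \<le> 2 * (C * (1 / \<alpha> + 1 / \<beta>) + V * (2 * \<delta>))"
  proof -
    have "u + v + w + x \<le> 2 * (y + z)" if "u \<le> y" "v \<le> z" "w \<le> y" "x \<le> z" for u v w x y z :: real
      using that by simp
    then show ?thesis using e1 e2 e3 e4 unfolding len .
  qed
  finally have *: "cmod (contour_integral (rectpath p q) \<Phi>) \<le> 2 * (C * (1 / \<alpha> + 1 / \<beta>) + V * (2 * \<delta>))" .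
  have "cmod (integral {a..b} (\<lambda>x. F (of_real x)) - (\<Sum>k\<in>{-int m..int m}. F (of_real (real_of_int k * h))
            * of_real (J k h b - J k h a))) = cmod (contour_integral (rectpath p q) \<Phi>) / (2 * pi)"
    unfolding main(1) by (simp add: norm_mult norm_divide)
  also have "\<dots> \<le> 2 * (C * (1 / \<alpha> + 1 / \<beta>) + V * (2 * \<delta>)) / (2 * pi)"
    using * by (rule divide_right_mono) simp
  also have "\<dots> = (C * (1 / \<alpha> + 1 / \<beta>) + V * (2 * \<delta>)) / pi"
    by (rule mult_divide_mult_cancel_left) simp
  also have "C * (1 / \<alpha> + 1 / \<beta>) = A * (1 / \<alpha> + 1 / \<beta>) * (h / \<delta>) / sinh (pi * \<delta> / h)"
    by (simp add: C_def s_def mult_ac)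
  finally show ?thesis by (simp only: V_def)
qed

subsection \<open>Truncation error\<close>

text \<open>A right Riemann sum of a decreasing function is at most its integral. The induction
  telescopes, with 1 + \<beta> h <= exp(\<beta> h) in place of the integral comparison.\<close>

lemma sum_exp_tail_le:
  fixes \<beta> h :: real and N :: int
  assumes "\<beta> > 0" "h > 0"
  shows "(\<Sum>k\<in>{N<..L}. h * exp (- \<beta> * (real_of_int k * h))) \<le> exp (- \<beta> * (real_of_int N * h)) / \<beta>"
proof -
  define e where "e k = exp (- \<beta> * (real_of_int k * h))" for k :: int
  have step: "h * e (k + 1) \<le> (e k - e (k + 1)) / \<beta>" for k
  proof -
    have "e k = e (k + 1) * exp (\<beta> * h)"
      unfolding e_def exp_add[symmetric] by (simp add: algebra_simps)
    moreover have "e (k + 1) * (1 + \<beta> * h) \<le> e (k + 1) * exp (\<beta> * h)"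
      by (intro mult_left_mono exp_ge_add_one_self) (auto simp: e_def)
    ultimately show ?thesis using assms by (simp add: field_simps)
  qed
  have "(\<Sum>k\<in>{N<..N + int n}. h * e k) \<le> (e N - e (N + int n)) / \<beta>" for n
  proof (induction n)
    case (Suc n)
    have "{N<..N + int (Suc n)} = insert (N + int n + 1) {N<..N + int n}" by auto
    then have "(\<Sum>k\<in>{N<..N + int (Suc n)}. h * e k) = h * e (N + int n + 1) + (\<Sum>k\<in>{N<..N + int n}. h * e k)"
      by simp
    also have "\<dots> \<le> (e (N + int n) - e (N + int n + 1)) / \<beta> + (e N - e (N + int n)) / \<beta>"
      using step Suc.IH by (intro add_mono)
    also have "\<dots> = (e N - e (N + int (Suc n))) / \<beta>"
      by (simp add: diff_divide_distrib add_ac)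
    finally show ?case .
  qed simp
  from this[of "nat (L - N)"] have "(\<Sum>k\<in>{N<..L}. h * e k) \<le> (e N - e (N + int (nat (L - N)))) / \<beta>"
    by (cases "N \<le> L") (auto simp: e_def)
  also have "\<dots> \<le> e N / \<beta>"
    using assms by (intro divide_right_mono) (auto simp: e_def)
  finally show ?thesis by (simp add: e_def)
qed

text \<open>The bound depends neither on m nor on x. Both matter: the lemma serves at the end point
  \<xi> for the window M, N, and again at the receding left end point for a symmetric
  window.\<close>

lemma sinc_truncation_error_le:
  fixes F :: "real \<Rightarrow> complex" and M N :: int and m :: nat
  assumes h: "h > 0" and pos: "B \<ge> 0" "\<alpha> > 0" "\<beta> > 0"
    and bd: "\<And>x. cmod (F x) \<le> B * exp (\<alpha> * x)" "\<And>x. cmod (F x) \<le> B * exp (- \<beta> * x)"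
  shows "cmod (\<Sum>k\<in>{-int m..int m} - {-M..N}. F (real_of_int k * h) * of_real (J k h x))
     \<le> 1.1 * B * (exp (- \<alpha> * (real_of_int M * h)) / \<alpha> + exp (- \<beta> * (real_of_int N * h)) / \<beta>)"
proof -
  define S where "S = {-int m..int m} - {-M..N}"
  have FJ: "cmod (F (real_of_int k * h) * of_real (J k h x)) \<le> 1.1 * B * (h * exp (- \<gamma> * (real_of_int j * h)))"
    if "cmod (F (real_of_int k * h)) \<le> B * exp (- \<gamma> * (real_of_int j * h))" for k j \<gamma>
  proof -
    have "cmod (F (real_of_int k * h)) * \<bar>J k h x\<bar> \<le> (B * exp (- \<gamma> * (real_of_int j * h))) * (1.1 * h)"
      using that abs_J_le[OF h] pos h by (intro mult_mono) auto
    then show ?thesis by (simp add: norm_mult mult_ac)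
  qed
  have 1: "cmod (F (real_of_int k * h) * of_real (J k h x)) \<le> 1.1 * B * (h * exp (- \<alpha> * (real_of_int (- k) * h)))" for k
    using bd(1)[of "real_of_int k * h"] by (intro FJ) simp
  have 2: "cmod (F (real_of_int k * h) * of_real (J k h x)) \<le> 1.1 * B * (h * exp (- \<beta> * (real_of_int k * h)))" for k
    by (intro FJ bd(2))
  have "cmod (\<Sum>k\<in>S. F (real_of_int k * h) * of_real (J k h x))
     \<le> (\<Sum>k\<in>S. cmod (F (real_of_int k * h) * of_real (J k h x)))"
    by (rule norm_sum)
  also have "\<dots> \<le> (\<Sum>k\<in>{-int m..<-M} \<union> {N<..int m}. cmod (F (real_of_int k * h) * of_real (J k h x)))"
    by (rule sum_mono2) (auto simp: S_def)
  also have "\<dots> \<le> (\<Sum>k\<in>{-int m..<-M}. cmod (F (real_of_int k * h) * of_real (J k h x)))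
     + (\<Sum>k\<in>{N<..int m}. cmod (F (real_of_int k * h) * of_real (J k h x)))"
  proof -
    \<comment> \<open>Only an inequality, since the two tails overlap when M + N is sufficiently
      negative.\<close>
    have "(\<Sum>k\<in>P \<union> Q. c k) \<le> (\<Sum>k\<in>P. c k) + (\<Sum>k\<in>Q. c k)"
      if "finite P" "finite Q" "\<And>k. c k \<ge> 0" for P Q :: "int set" and c :: "int \<Rightarrow> real"
      using sum.union_inter[OF that(1,2), of c] sum_nonneg[of "P \<inter> Q" c] that(3) by simp
    then show ?thesis by (simp add: norm_ge_zero del: norm_mult)
  qed
  also have "\<dots> \<le> (\<Sum>k\<in>{-int m..<-M}. 1.1 * B * (h * exp (- \<alpha> * (real_of_int (- k) * h))))
     + (\<Sum>k\<in>{N<..int m}. 1.1 * B * (h * exp (- \<beta> * (real_of_int k * h))))"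
    by (intro add_mono sum_mono 1 2)
  also have "(\<Sum>k\<in>{-int m..<-M}. 1.1 * B * (h * exp (- \<alpha> * (real_of_int (- k) * h))))
      = (\<Sum>k\<in>{M<..int m}. 1.1 * B * (h * exp (- \<alpha> * (real_of_int k * h))))"
    by (rule sum.reindex_bij_witness[of _ uminus uminus]) auto
  also have "\<dots> + (\<Sum>k\<in>{N<..int m}. 1.1 * B * (h * exp (- \<beta> * (real_of_int k * h))))
     = 1.1 * B * ((\<Sum>k\<in>{M<..int m}. h * exp (- \<alpha> * (real_of_int k * h))) + (\<Sum>k\<in>{N<..int m}. h * exp (- \<beta> * (real_of_int k * h))))"
    by (simp only: sum_distrib_left distrib_left)
  also have "\<dots> \<le> 1.1 * B * (exp (- \<alpha> * (real_of_int M * h)) / \<alpha> + exp (- \<beta> * (real_of_int N * h)) / \<beta>)"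
    using pos h by (intro mult_left_mono add_mono sum_exp_tail_le) auto
  finally show ?thesis by (simp only: S_def)
qed

text \<open>\<open>A\<close> bounds F on the whole strip and governs the discretization;
  \<open>B\<close> bounds F on the real line and governs the truncation. The integral is given as a
  limit \<open>I\<close> because the interval is unbounded to the left.\<close>

lemma sinc_indefinite_integration_error:
  fixes F :: "complex \<Rightarrow> complex" and M N :: int and I :: complex
  assumes F: "F holomorphic_on strip d" and h: "h > 0" and d: "0 < d"
    and pos: "A \<ge> 0" "B \<ge> 0" "\<alpha> > 0" "\<beta> > 0"
    and bd: "\<And>z. z \<in> strip d \<Longrightarrow> cmod (F z) \<le> A * exp (\<alpha> * Re z)"
            "\<And>z. z \<in> strip d \<Longrightarrow> cmod (F z) \<le> A * exp (- \<beta> * Re z)"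
    and rbd: "\<And>x. cmod (F (of_real x)) \<le> B * exp (\<alpha> * x)"
             "\<And>x. cmod (F (of_real x)) \<le> B * exp (- \<beta> * x)"
    and I: "((\<lambda>a. integral {a..\<xi>} (\<lambda>x. F (of_real x))) \<longlongrightarrow> I) at_bot"
  shows "cmod (I - (\<Sum>k\<in>{-M..N}. F (of_real (real_of_int k * h)) * of_real (J k h \<xi>)))
     \<le> A * (1 / \<alpha> + 1 / \<beta>) * (h / d) / sinh (pi * d / h) / pi
        + 1.1 * B * (exp (- \<alpha> * (real_of_int M * h)) / \<alpha> + exp (- \<beta> * (real_of_int N * h)) / \<beta>)"
proof -
  define err where "err = cmod (I - (\<Sum>k\<in>{-M..N}. F (of_real (real_of_int k * h)) * of_real (J k h \<xi>)))"
  define D where "D \<delta> = A * (1 / \<alpha> + 1 / \<beta>) * (h / \<delta>) / sinh (pi * \<delta> / h) / pi" for \<delta>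
  define T where "T M N = 1.1 * B * (exp (- \<alpha> * (real_of_int M * h)) / \<alpha> + exp (- \<beta> * (real_of_int N * h)) / \<beta>)" for M N
  define f where "f k = F (of_real (real_of_int k * h))" for k :: int
  \<comment> \<open>The left end point recedes at half the speed of the rectangle, so it stays away from its sides.\<close>
  define a where "a m = - real m * h / 2" for m :: nat
  have a_bot: "filterlim a at_bot sequentially"
    unfolding a_def using h by real_asymp
  define V where "V \<delta> m = A * exp (- min \<alpha> \<beta> * ((real m + 1/2) * h)) * ((\<xi> - (- real m * h / 2)) / ((real m + 1/2) * h - real m * h / 2)) * (2 * \<delta>) / pi"
    for \<delta> m
  have tri: "cmod (u + v + w - x - y) \<le> cmod u + cmod v + cmod w + cmod x + cmod y" for u v w x y
    using norm_triangle_ineq4[of "u + v + w - x" y] norm_triangle_ineq4[of "u + v + w" x]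
      norm_triangle_ineq[of "u + v" w] norm_triangle_ineq[of u v] by linarith
  define e1 where "e1 m = cmod (I - integral {a m..\<xi>} (\<lambda>x. F (of_real x)))" for m
  have trunc: "cmod (\<Sum>k\<in>{-int m..int m} - {-M..N}. f k * of_real (J k h x)) \<le> T M N" for m M N x
    unfolding T_def f_def using sinc_truncation_error_le[OF h pos(2,3,4), of "\<lambda>x. F (of_real x)"] rbd by blast
  \<comment> \<open>The sum of F(kh) J(k,h)(a) has a growing number of terms while a recedes. It is
    cut at a fixed \<open>m0\<close>: each central term tends to 0, and the outer ones are dominated
    by \<open>T m0 m0\<close> uniformly in m.\<close>
  have main: "err \<le> e1 m + (D \<delta> + V \<delta> m) + T M N + (\<Sum>k\<in>{-int m0..int m0}. cmod (f k) * \<bar>J k h (a m)\<bar>) + T m0 m0"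
    if \<delta>: "0 < \<delta>" "\<delta> < d" and m: "m0 \<le> m" "nat \<bar>M\<bar> \<le> m" "nat \<bar>N\<bar> \<le> m" "2 * \<bar>\<xi>\<bar> / h \<le> real m"
    for \<delta> m m0
  proof -
    define W where "W = {-int m..int m}"
    have sub: "{-M..N} \<subseteq> W" "{-int m0..int m0} \<subseteq> W" using m by (auto simp: W_def)
    have fin: "finite W" by (simp add: W_def)
    have s1: "(\<Sum>k\<in>W. f k * of_real (J k h \<xi>)) = (\<Sum>k\<in>{-M..N}. f k * of_real (J k h \<xi>)) + (\<Sum>k\<in>W - {-M..N}. f k * of_real (J k h \<xi>))"
      by (simp only: sum.subset_diff[OF sub(1) fin] add.commute)
    have s2: "(\<Sum>k\<in>W. f k * of_real (J k h (a m))) = (\<Sum>k\<in>{-int m0..int m0}. f k * of_real (J k h (a m))) + (\<Sum>k\<in>W - {-int m0..int m0}. f k * of_real (J k h (a m)))"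
      by (simp only: sum.subset_diff[OF sub(2) fin] add.commute)
    have s3: "(\<Sum>k\<in>W. f k * of_real (J k h \<xi> - J k h (a m))) = (\<Sum>k\<in>W. f k * of_real (J k h \<xi>)) - (\<Sum>k\<in>W. f k * of_real (J k h (a m)))"
      by (simp add: sum_subtractf algebra_simps)
    define X where "X = integral {a m..\<xi>} (\<lambda>x. F (of_real x)) - (\<Sum>k\<in>W. f k * of_real (J k h \<xi> - J k h (a m)))"
    have "\<bar>\<xi>\<bar> \<le> real m * h / 2" using m(4) h by (simp add: field_simps)
    then have "cmod X \<le> (A * (1 / \<alpha> + 1 / \<beta>) * (h / \<delta>) / sinh (pi * \<delta> / h)
           + A * exp (- min \<alpha> \<beta> * ((real m + 1/2) * h)) * ((\<xi> - a m) / ((real m + 1/2) * h - real m * h / 2)) * (2 * \<delta>)) / pi"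
      unfolding X_def W_def f_def using h
      by (intro sinc_indefinite_discretization_rectangle[OF F h \<delta> pos(1,3,4) bd refl])
         (auto simp: a_def field_simps)
    then have Xb: "cmod X \<le> D \<delta> + V \<delta> m"
      by (simp only: D_def V_def a_def add_divide_distrib)
    have ns: "cmod (\<Sum>k\<in>{-int m0..int m0}. f k * of_real (J k h (a m)))
        \<le> (\<Sum>k\<in>{-int m0..int m0}. cmod (f k) * \<bar>J k h (a m)\<bar>)"
      by (rule order_trans[OF norm_sum]) (simp add: norm_mult)
    have "I - (\<Sum>k\<in>{-M..N}. f k * of_real (J k h \<xi>)) = (I - integral {a m..\<xi>} (\<lambda>x. F (of_real x))) + X
       + (\<Sum>k\<in>W - {-M..N}. f k * of_real (J k h \<xi>))
       - (\<Sum>k\<in>{-int m0..int m0}. f k * of_real (J k h (a m))) - (\<Sum>k\<in>W - {-int m0..int m0}. f k * of_real (J k h (a m)))"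
      unfolding X_def s3 s1 s2 by simp
    also have "cmod \<dots> \<le> e1 m + cmod X + cmod (\<Sum>k\<in>W - {-M..N}. f k * of_real (J k h \<xi>))
       + cmod (\<Sum>k\<in>{-int m0..int m0}. f k * of_real (J k h (a m))) + cmod (\<Sum>k\<in>W - {-int m0..int m0}. f k * of_real (J k h (a m)))"
      unfolding e1_def by (rule tri)
    also have "\<dots> \<le> e1 m + (D \<delta> + V \<delta> m) + T M N + (\<Sum>k\<in>{-int m0..int m0}. cmod (f k) * \<bar>J k h (a m)\<bar>) + T m0 m0"
      using trunc[of \<xi> m M N] trunc[of "a m" m "int m0" "int m0"]
      by (intro add_mono order_refl Xb ns) (auto simp: W_def)
    finally show ?thesis by (simp add: err_def f_def)
  qed
  have V0: "V \<delta> \<longlonglongrightarrow> 0" for \<delta>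
    unfolding V_def using h pos by real_asymp
  have e10: "e1 \<longlonglongrightarrow> 0"
    unfolding e1_def using filterlim_compose[OF I a_bot]
    by (auto intro!: tendsto_eq_intros)
  have J0: "(\<lambda>m. \<Sum>k\<in>{-int m0..int m0}. cmod (f k) * \<bar>J k h (a m)\<bar>) \<longlonglongrightarrow> 0" for m0
  proof -
    have "(\<lambda>m. \<Sum>k\<in>{-int m0..int m0}. cmod (f k) * \<bar>J k h (a m)\<bar>) \<longlonglongrightarrow> (\<Sum>k\<in>{-int m0..int m0}. cmod (f k) * \<bar>0\<bar>)"
      by (intro tendsto_intros filterlim_compose[OF J_at_bot[OF h] a_bot])
    then show ?thesis by simp
  qed
  \<comment> \<open>m tends to infinity with \<open>m0\<close> and \<delta> fixed.\<close>
  have step1: "err \<le> D \<delta> + T M N + T m0 m0" if \<delta>: "0 < \<delta>" "\<delta> < d" for \<delta> and m0 :: nat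
  proof -
    have "(\<lambda>m. e1 m + (D \<delta> + V \<delta> m) + T M N + (\<Sum>k\<in>{-int m0..int m0}. cmod (f k) * \<bar>J k h (a m)\<bar>) + T m0 m0)
       \<longlonglongrightarrow> 0 + (D \<delta> + 0) + T M N + 0 + T m0 m0"
      by (intro tendsto_intros e10 V0 J0)
    moreover have "eventually (\<lambda>m. err \<le> e1 m + (D \<delta> + V \<delta> m) + T M N + (\<Sum>k\<in>{-int m0..int m0}. cmod (f k) * \<bar>J k h (a m)\<bar>) + T m0 m0) sequentially"
      using eventually_ge_at_top[of m0] eventually_ge_at_top[of "nat \<bar>M\<bar>"] eventually_ge_at_top[of "nat \<bar>N\<bar>"]
        eventually_ge_at_top[of "nat \<lceil>2 * \<bar>\<xi>\<bar> / h\<rceil>"]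
      by eventually_elim (rule main[OF \<delta>], auto simp: nat_le_iff ceiling_le_iff)
    ultimately have "err \<le> 0 + (D \<delta> + 0) + T M N + 0 + T m0 m0"
      by (rule tendsto_lowerbound) simp
    then show ?thesis by simp
  qed
  \<comment> \<open>Now the cut \<open>m0\<close> tends to infinity.\<close>
  have step2: "err \<le> D \<delta> + T M N" if \<delta>: "0 < \<delta>" "\<delta> < d" for \<delta>
  proof -
    have "(\<lambda>m0::nat. exp (- \<alpha> * (real m0 * h)) / \<alpha>) \<longlonglongrightarrow> 0" "(\<lambda>m0::nat. exp (- \<beta> * (real m0 * h)) / \<beta>) \<longlonglongrightarrow> 0"
      using h pos by real_asymp+
    then have "(\<lambda>m0::nat. D \<delta> + T M N + 1.1 * B * (exp (- \<alpha> * (real m0 * h)) / \<alpha> + exp (- \<beta> * (real m0 * h)) / \<beta>))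
       \<longlonglongrightarrow> D \<delta> + T M N + 1.1 * B * (0 + 0)"
      by (intro tendsto_intros)
    then have "(\<lambda>m0::nat. D \<delta> + T M N + T m0 m0) \<longlonglongrightarrow> D \<delta> + T M N"
      by (simp add: T_def)
    from tendsto_lowerbound[OF this] show ?thesis using step1[OF \<delta>] by simp
  qed
  \<comment> \<open>The boundary of the strip is reached only here, through the explicit bound
    \<open>D\<close>, which is continuous at d; F itself need not extend there.\<close>
  have "(D \<longlongrightarrow> D d) (at_left d)"
    unfolding D_def using d h by (intro tendsto_intros) auto
  then have "((\<lambda>\<delta>. D \<delta> + T M N) \<longlongrightarrow> D d + T M N) (at_left d)"
    by (intro tendsto_intros)
  moreover have "eventually (\<lambda>\<delta>. err \<le> D \<delta> + T M N) (at_left d)"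
    using eventually_at_left_real[OF d] by eventually_elim (use step2 in auto)
  ultimately have "err \<le> D d + T M N"
    by (rule tendsto_lowerbound) simp
  then show ?thesis by (simp only: err_def D_def T_def)
qed

subsection \<open>The inverse hyperbolic sine on the right half-plane\<close>

text \<open>With r = |w| and v = Im w one has |1 + w^2|^2 = (1 + r^2)^2 - 4 v^2. The sector gives
  v^2 <= r^2 (1 - c^2), and 4 r^2 <= (1 + r^2)^2 does the rest. For c = 1 it is an equality.\<close>

lemma norm_one_plus_square_ge:
  fixes w :: complex
  assumes c: "0 \<le> c" "c \<le> 1" and w: "c * cmod w \<le> Re w"
  shows "c * (1 + (cmod w)\<^sup>2) \<le> cmod (w\<^sup>2 + 1)"
proof (rule power2_le_imp_le)
  define u v r where "u = Re w" and "v = Im w" and "r = cmod w"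
  have r2: "r\<^sup>2 = u\<^sup>2 + v\<^sup>2" by (simp add: r_def u_def v_def cmod_power2)
  have e: "(cmod (w\<^sup>2 + 1))\<^sup>2 = (1 + r\<^sup>2)\<^sup>2 - 4 * v\<^sup>2"
  proof -
    have "Re (w\<^sup>2 + 1) = u\<^sup>2 - v\<^sup>2 + 1" "Im (w\<^sup>2 + 1) = 2 * u * v"
      by (simp_all add: u_def v_def power2_eq_square)
    then have "(cmod (w\<^sup>2 + 1))\<^sup>2 = (u\<^sup>2 - v\<^sup>2 + 1)\<^sup>2 + (2 * u * v)\<^sup>2"
      by (simp only: cmod_power2)
    then show ?thesis unfolding r2 by (simp add: power2_eq_square algebra_simps)
  qed
  have "(c * r)\<^sup>2 \<le> u\<^sup>2"
    using w c by (intro power_mono) (auto simp: r_def u_def)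
  then have "4 * v\<^sup>2 \<le> 4 * r\<^sup>2 * (1 - c\<^sup>2)"
    using r2 by (simp add: power_mult_distrib algebra_simps)
  also have "\<dots> \<le> (1 + r\<^sup>2)\<^sup>2 * (1 - c\<^sup>2)"
  proof (rule mult_right_mono)
    have "0 \<le> (1 - r\<^sup>2)\<^sup>2" by simp
    then show "4 * r\<^sup>2 \<le> (1 + r\<^sup>2)\<^sup>2" by (simp add: power2_eq_square algebra_simps)
    show "0 \<le> 1 - c\<^sup>2" using c by (simp add: power_le_one)
  qed
  also have "(1 + r\<^sup>2)\<^sup>2 * (1 - c\<^sup>2) = (1 + r\<^sup>2)\<^sup>2 - (c * (1 + r\<^sup>2))\<^sup>2"
    unfolding power_mult_distrib right_diff_distrib by simp
  finally show "(c * (1 + (cmod w)\<^sup>2))\<^sup>2 \<le> (cmod (w\<^sup>2 + 1))\<^sup>2"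
    unfolding e unfolding r_def by simp
qed simp

lemma arsinh_complex_def: "arsinh (w::complex) = Ln (w + csqrt (w\<^sup>2 + 1))"
  by (simp add: arsinh_def csqrt_conv_powr)

lemma square_plus_one_not_nonpos:
  fixes w :: complex
  assumes "0 < Re w \<or> w = 0"
  shows "w\<^sup>2 + 1 \<notin> \<real>\<^sub>\<le>\<^sub>0"
proof
  assume "w\<^sup>2 + 1 \<in> \<real>\<^sub>\<le>\<^sub>0"
  then have *: "Im (w\<^sup>2 + 1) = 0" "Re (w\<^sup>2 + 1) \<le> 0" by (auto simp: complex_nonpos_Reals_iff)
  have "Im (w\<^sup>2 + 1) = 2 * (Re w * Im w)" by (simp add: power2_eq_square)
  then have "Im w = 0" using *(1) assms by auto
  then have "Re (w\<^sup>2 + 1) = (Re w)\<^sup>2 + 1" by (simp add: power2_eq_square)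
  then show False using *(2) zero_le_power2[of "Re w"] by linarith
qed

lemma Re_csqrt_pos:
  assumes "z \<notin> \<real>\<^sub>\<le>\<^sub>0"
  shows "0 < Re (csqrt z)"
proof -
  have "Re (csqrt z) \<noteq> 0"
  proof
    assume 0: "Re (csqrt z) = 0"
    have "z = (csqrt z)\<^sup>2" by simp
    also have "\<dots> = of_real (- (Im (csqrt z))\<^sup>2)"
      using 0 by (simp add: complex_eq_iff power2_eq_square)
    also have "\<dots> \<in> \<real>\<^sub>\<le>\<^sub>0" by (subst nonpos_Reals_of_real_iff) simp
    finally show False using assms by simp
  qed
  then show ?thesis using csqrt_principal[of z] by auto
qed

context
  fixes w s z :: complex
  assumes w: "0 < Re w \<or> w = 0"
  defines "s \<equiv> csqrt (w\<^sup>2 + 1)" and "z \<equiv> arsinh w"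
begin

lemma csqrt_square_plus_one: "s\<^sup>2 = w\<^sup>2 + 1" "0 < Re s" "w + s \<noteq> 0" "w + s \<notin> \<real>\<^sub>\<le>\<^sub>0"
proof -
  show "s\<^sup>2 = w\<^sup>2 + 1" by (simp add: s_def)
  show s0: "0 < Re s" unfolding s_def by (intro Re_csqrt_pos square_plus_one_not_nonpos w)
  then have "0 < Re (w + s)" using w by auto
  then show "w + s \<noteq> 0" "w + s \<notin> \<real>\<^sub>\<le>\<^sub>0" 
    by (metis less_irrefl zero_complex.sel(1), metis complex_nonpos_Reals_iff not_le)
qed

lemma exp_arsinh: "exp z = w + s" "exp (- z) = s - w"
proof -
  show 1: "exp z = w + s" using csqrt_square_plus_one(3) by (simp add: z_def arsinh_complex_def s_def)
  have "(w + s) * (s - w) = 1" using csqrt_square_plus_one(1) by (simp add: algebra_simps power2_eq_square)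
  then show "exp (- z) = s - w" unfolding exp_minus 1 by (rule inverse_unique)
qed

text \<open>The vectors w and s enclose at most a right angle, so |w + s|^2 >= |w|^2 + |s|^2 and |w
  + s| >= |s - w|. The product of the last two moduli is 1, which forces |exp z| >= 1.\<close>

lemma norm_exp_arsinh:
  "(cmod w)\<^sup>2 + cmod (w\<^sup>2 + 1) \<le> (cmod (exp z))\<^sup>2" "1 \<le> cmod (exp z)" "0 \<le> Re z"
proof -
  have "Im (s\<^sup>2) = Im (w\<^sup>2 + 1)" by (simp only: csqrt_square_plus_one(1))
  moreover have "Im (s\<^sup>2) = 2 * (Re s * Im s)" "Im (w\<^sup>2 + 1) = 2 * (Re w * Im w)"
    by (simp_all add: power2_eq_square)
  ultimately have q: "Re s * Im s = Re w * Im w" by linarith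
  \<comment> \<open>Multiplying by Re s > 0 turns the mixed term Re s Im s into Re w Im w, which
    makes the expression visibly nonnegative.\<close>
  have "0 \<le> Re (w * cnj s)"
  proof -
    have "Re s * Re (w * cnj s) = Re w * (Re s)\<^sup>2 + Im w * (Re s * Im s)"
      by (simp add: algebra_simps power2_eq_square)
    also have "\<dots> = Re w * ((Re s)\<^sup>2 + (Im w)\<^sup>2)"
      unfolding q by (simp add: algebra_simps power2_eq_square)
    also have "\<dots> \<ge> 0" using w by auto
    finally show ?thesis using csqrt_square_plus_one(2) by (simp add: zero_le_mult_iff)
  qed
  then have i: "0 \<le> Re w * Re s + Im w * Im s" by simp
  have "(cmod s)\<^sup>2 = cmod (w\<^sup>2 + 1)"
    by (simp add: csqrt_square_plus_one(1) flip: norm_power)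
  moreover have p: "(cmod (w + s))\<^sup>2 = (cmod w)\<^sup>2 + (cmod s)\<^sup>2 + 2 * (Re w * Re s + Im w * Im s)"
    unfolding cmod_power2 plus_complex.sel minus_complex.sel by (simp add: power2_eq_square algebra_simps)
  ultimately show "(cmod w)\<^sup>2 + cmod (w\<^sup>2 + 1) \<le> (cmod (exp z))\<^sup>2"
    unfolding exp_arsinh using i by simp
  have m: "(cmod (s - w))\<^sup>2 = (cmod w)\<^sup>2 + (cmod s)\<^sup>2 - 2 * (Re w * Re s + Im w * Im s)"
    unfolding cmod_power2 plus_complex.sel minus_complex.sel by (simp add: power2_eq_square algebra_simps)
  have "(cmod (s - w))\<^sup>2 \<le> (cmod (w + s))\<^sup>2"
  proof -
    have "x - 2 * t \<le> x + 2 * t" if "0 \<le> t" for x t :: real using that by simp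
    then show ?thesis unfolding p m using i .
  qed
  then have "cmod (s - w) \<le> cmod (w + s)" by (rule power2_le_imp_le) simp
  have "cmod (w + s) * cmod (s - w) = 1"
    unfolding exp_arsinh[symmetric] norm_mult[symmetric] by (simp flip: exp_add)
  moreover have "cmod (w + s) * cmod (s - w) \<le> cmod (w + s) * cmod (w + s)"
    using \<open>cmod (s - w) \<le> cmod (w + s)\<close> by (rule mult_left_mono) simp
  ultimately have "1\<^sup>2 \<le> (cmod (w + s))\<^sup>2" by (simp only: power2_eq_square mult_1)
  then have "1 \<le> cmod (w + s)" by (rule power2_le_imp_le) simp
  then show 1: "1 \<le> cmod (exp z)" by (simp only: exp_arsinh)
  then show "0 \<le> Re z" by simp
qed

lemma sinh_arsinh_complex: "sinh z = w"
  by (simp add: sinh_field_def exp_arsinh)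

lemma has_field_derivative_arsinh_complex: "(arsinh has_field_derivative 1 / s) (at w)"
proof -
  have nz: "s \<noteq> 0" using csqrt_square_plus_one(2) by auto
  have "((\<lambda>w. csqrt (w\<^sup>2 + 1)) has_field_derivative (w / s)) (at w)"
  proof -
    have "((\<lambda>w. w\<^sup>2 + 1) has_field_derivative 2 * w) (at w)"
      by (auto intro!: derivative_eq_intros)
    from DERIV_chain2[OF has_field_derivative_csqrt[OF square_plus_one_not_nonpos[OF w]] this]
    have "((\<lambda>w. csqrt (w\<^sup>2 + 1)) has_field_derivative (inverse (2 * s) * (2 * w))) (at w)"
      by (simp only: s_def)
    moreover have "inverse (2 * s) * (2 * w) = w / s" using nz by (simp add: field_simps)
    ultimately show ?thesis by (simp only:)
  qed
  then have "((\<lambda>w. w + csqrt (w\<^sup>2 + 1)) has_field_derivative (1 + w / s)) (at w)"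
    by (rule DERIV_add[OF DERIV_ident])
  from DERIV_chain2[OF has_field_derivative_Ln[OF csqrt_square_plus_one(4)[unfolded s_def]] this]
  have "((\<lambda>w. Ln (w + csqrt (w\<^sup>2 + 1))) has_field_derivative (inverse (w + s) * (1 + w / s))) (at w)"
    by (simp only: s_def)
  also have "inverse (w + s) * (1 + w / s) = 1 / s"
  proof -
    have "1 + w / s = (w + s) * (1 / s)" using nz by (simp add: add_divide_distrib add.commute)
    then show ?thesis by (simp only: mult.assoc[symmetric] left_inverse[OF csqrt_square_plus_one(3)] mult_1_left)
  qed
  finally show ?thesis by (simp add: arsinh_complex_def[abs_def])
qed

text \<open>The mean value inequality for sinh on [0,z] gives |w| <= cosh(Re z) |z|. Then 2 cosh(Re
  z) = |w + s| + |s - w|; the parallelogram law and |w + s| |s - w| = 1 bound its square by 4 (1 +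
  |w|^2).\<close>

lemma norm_le_norm_arsinh: "cmod w \<le> cmod z * sqrt (1 + (cmod w)\<^sup>2)"
proof -
  define X where "X = Re z"
  have "cmod (sinh z - sinh 0) \<le> cosh X * cmod (z - 0)"
  proof (rule field_differentiable_bound[where S = "closed_segment 0 z" and f' = cosh])
    fix y assume "y \<in> closed_segment 0 z"
    then obtain t where t: "0 \<le> t" "t \<le> 1" "y = of_real t * z"
      by (auto simp: closed_segment_def scaleR_conv_of_real)
    show "(sinh has_field_derivative cosh y) (at y within closed_segment 0 z)"
      by (auto intro!: derivative_eq_intros)
    have "cmod (cosh y) \<le> (cmod (exp y) + cmod (exp (- y))) / 2"
      using norm_triangle_ineq[of "exp y" "exp (- y)"] by (simp add: cosh_field_def norm_divide)
    also have "\<dots> = cosh (t * X)" by (simp add: cosh_field_def t X_def)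
    also have "\<dots> \<le> cosh X"
    proof -
      have "t * X \<le> 1 * X" using t norm_exp_arsinh(3) by (intro mult_right_mono) (auto simp: X_def)
      then show ?thesis
        using t norm_exp_arsinh(3) by (subst cosh_real_nonneg_le_iff) (auto simp: X_def)
    qed
    finally show "cmod (cosh y) \<le> cosh X" .
  qed (auto simp: convex_closed_segment)
  then have 1: "cmod w \<le> cosh X * cmod z" by (simp add: sinh_arsinh_complex)
  have "cosh X = (cmod (w + s) + cmod (s - w)) / 2"
    by (simp add: cosh_field_def X_def flip: exp_arsinh)
  also have "\<dots> \<le> sqrt (1 + (cmod w)\<^sup>2)"
  proof (rule real_le_rsqrt)
    have "cmod (w + s) * cmod (s - w) = 1"
      unfolding exp_arsinh[symmetric] norm_mult[symmetric] by (simp flip: exp_add)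
    moreover have "(cmod (w + s))\<^sup>2 + (cmod (s - w))\<^sup>2 = 2 * ((cmod w)\<^sup>2 + (cmod s)\<^sup>2)"
      unfolding cmod_power2 plus_complex.sel minus_complex.sel by (simp add: power2_eq_square algebra_simps)
    ultimately have "(cmod (w + s) + cmod (s - w))\<^sup>2 = 2 * ((cmod w)\<^sup>2 + (cmod s)\<^sup>2) + 2"
      unfolding power2_sum mult.assoc by (simp only: mult_1_right)
    moreover have "(cmod s)\<^sup>2 \<le> (cmod w)\<^sup>2 + 1"
    proof -
      have "(cmod s)\<^sup>2 = cmod (w\<^sup>2 + 1)" by (simp add: csqrt_square_plus_one(1) flip: norm_power)
      also have "\<dots> \<le> cmod (w\<^sup>2) + cmod 1" by (rule norm_triangle_ineq)
      finally show ?thesis by (simp add: norm_power)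
    qed
    ultimately show "((cmod (w + s) + cmod (s - w)) / 2)\<^sup>2 \<le> 1 + (cmod w)\<^sup>2"
      by (simp add: power_divide)
  qed
  finally have "cosh X * cmod z \<le> sqrt (1 + (cmod w)\<^sup>2) * cmod z"
    by (rule mult_right_mono) simp
  then show ?thesis using 1 by (simp add: mult.commute)
qed

end

text \<open>The sector is star-shaped about 0, and on it the derivative 1/sqrt(1 + y^2) has modulus
  at most 1/sqrt c.\<close>

lemma norm_arsinh_le:
  fixes w :: complex
  assumes c: "0 < c" "c \<le> 1" and w: "c * cmod w \<le> Re w"
  shows "cmod (arsinh w) \<le> cmod w / sqrt c"
proof -
  have "cmod (arsinh w - arsinh 0) \<le> 1 / sqrt c * cmod (w - 0)"
  proof (rule field_differentiable_bound[where S = "closed_segment 0 w" and f' = "\<lambda>y. 1 / csqrt (y\<^sup>2 + 1)"])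
    fix y assume "y \<in> closed_segment 0 w"
    then obtain t where t: "0 \<le> t" "t \<le> 1" "y = of_real t * w"
      by (auto simp: closed_segment_def scaleR_conv_of_real)
    have yc: "c * cmod y \<le> Re y"
      using mult_left_mono[OF w t(1)] t by (simp add: norm_mult mult_ac)
    then have "0 < Re y \<or> y = 0" using c
      by (metis less_le_trans mult_pos_pos zero_less_norm_iff)
    then show "(arsinh has_field_derivative 1 / csqrt (y\<^sup>2 + 1)) (at y within closed_segment 0 w)"
      by (rule has_field_derivative_at_within[OF has_field_derivative_arsinh_complex])
    have "c * 1 \<le> c * (1 + (cmod y)\<^sup>2)" using c by (intro mult_left_mono) auto
    also have "\<dots> \<le> cmod (y\<^sup>2 + 1)" using c yc by (intro norm_one_plus_square_ge) auto
    finally have "sqrt c \<le> cmod (csqrt (y\<^sup>2 + 1))" by simp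
    then show "cmod (1 / csqrt (y\<^sup>2 + 1)) \<le> 1 / sqrt c"
      using c unfolding norm_divide by (intro frac_le) auto
  qed (auto simp: convex_closed_segment)
  then show ?thesis by simp
qed

subsection \<open>Decay of the transformed integrand\<close>

text \<open>This profile is the common majorant for i = 2 and i = 3. With r = exp x, it lies below
  exp(\<alpha> x) and exp(-\<beta> x) simultaneously.\<close>

lemma envelope_le:
  fixes r \<alpha> \<beta> :: real
  assumes "0 < r" "0 < \<alpha>" "0 < \<beta>"
  shows "r powr \<alpha> * (1 + r\<^sup>2) powr (- ((\<alpha> + \<beta>) / 2)) \<le> r powr \<alpha>"
    and "r powr \<alpha> * (1 + r\<^sup>2) powr (- ((\<alpha> + \<beta>) / 2)) \<le> r powr (- \<beta>)"
proof -
  have "(1 + r\<^sup>2) powr (- ((\<alpha> + \<beta>) / 2)) \<le> 1 powr (- ((\<alpha> + \<beta>) / 2))"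
    using assms by (intro powr_mono2') auto
  then show "r powr \<alpha> * (1 + r\<^sup>2) powr (- ((\<alpha> + \<beta>) / 2)) \<le> r powr \<alpha>"
    by (simp add: mult_left_le)
  have "(1 + r\<^sup>2) powr (- ((\<alpha> + \<beta>) / 2)) \<le> (r powr 2) powr (- ((\<alpha> + \<beta>) / 2))"
    using assms by (intro powr_mono2') auto
  also have "\<dots> = r powr (- (\<alpha> + \<beta>))"
    unfolding powr_powr by (rule arg_cong[where f = "\<lambda>x. r powr x"]) (simp add: field_simps)
  finally have "r powr \<alpha> * (1 + r\<^sup>2) powr (- ((\<alpha> + \<beta>) / 2)) \<le> r powr \<alpha> * r powr (- (\<alpha> + \<beta>))"
    by (rule mult_left_mono) simp
  also have "\<dots> = r powr (- \<beta>)" by (simp flip: powr_add)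
  finally show "r powr \<alpha> * (1 + r\<^sup>2) powr (- ((\<alpha> + \<beta>) / 2)) \<le> r powr (- \<beta>)" .
qed

text \<open>The factor |w| is the modulus of the derivative of exp. The power of c becomes the power
  of cos d in C_2.\<close>

lemma norm_E2_le:
  fixes w :: complex
  assumes c: "0 < c" "c \<le> 1" and w: "c * cmod w \<le> Re w" "w \<noteq> 0" and ab: "0 < \<alpha>" "0 < \<beta>"
  shows "cmod (E 2 \<alpha> \<beta> w) * cmod w
     \<le> c powr (- ((\<alpha> + \<beta>) / 2)) * (cmod w powr \<alpha> * (1 + (cmod w)\<^sup>2) powr (- ((\<alpha> + \<beta>) / 2)))"
proof -
  define r where "r = cmod w"
  have r: "r > 0" using w by (simp add: r_def)
  define e where "e = - ((\<alpha> + \<beta>) / 2)"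
  have q: "0 < c * (1 + r\<^sup>2)" using c by (intro mult_pos_pos) (auto intro: add_pos_nonneg)
  have "- (\<alpha> + \<beta>) / 2 = e" unfolding e_def by (rule minus_divide_left[symmetric])
  then have "cmod (E 2 \<alpha> \<beta> w) = r powr (\<alpha> - 1) * cmod (w\<^sup>2 + 1) powr e"
    by (simp add: E_def norm_mult norm_powr_real_powr' r_def add.commute)
  then have "cmod (E 2 \<alpha> \<beta> w) * r = r powr \<alpha> * cmod (w\<^sup>2 + 1) powr e"
    using r by (simp add: powr_diff)
  also have "\<dots> \<le> r powr \<alpha> * (c * (1 + r\<^sup>2)) powr e"
  proof (rule mult_left_mono)
    show "cmod (w\<^sup>2 + 1) powr e \<le> (c * (1 + r\<^sup>2)) powr e"
      using ab q norm_one_plus_square_ge[of c w] c w by (intro powr_mono2') (auto simp: e_def r_def)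
  qed simp
  also have "(c * (1 + r\<^sup>2)) powr e = c powr e * (1 + r\<^sup>2) powr e"
    using c by (simp add: powr_mult)
  finally show ?thesis by (simp add: r_def e_def mult_ac)
qed

text \<open>The quotient w / sqrt(w^2 + 1) is the derivative of arsinh(exp). The power of 2 is
  2^max(1 - \<alpha>, 0), the price of the lower bound for |z/(1+z)| when \<alpha> < 1. That bound
  is free of c, which is why max(\<alpha>, 1) replaces \<alpha> in the exponent of c.\<close>

lemma norm_E3_le:
  fixes w :: complex
  assumes c: "0 < c" "c \<le> 1" and w: "c * cmod w \<le> Re w" "w \<noteq> 0" and ab: "0 < \<alpha>" "0 < \<beta>"
  shows "cmod (E 3 \<alpha> \<beta> (arsinh w)) * cmod (w / csqrt (w\<^sup>2 + 1))
     \<le> 2 powr ((1 - \<alpha> + \<bar>1 - \<alpha>\<bar>) / 2) * c powr (- ((max \<alpha> 1 + \<beta>) / 2))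
        * (cmod w powr \<alpha> * (1 + (cmod w)\<^sup>2) powr (- ((\<alpha> + \<beta>) / 2)))"
proof -
  define r where "r = cmod w"
  define z where "z = arsinh w"
  define p where "p = 1 + r\<^sup>2"
  define q where "q = c * p"
  have r: "r > 0" using w by (simp add: r_def)
  have Rew: "0 < Re w" using w c r by (metis less_le_trans mult_pos_pos zero_less_norm_iff)
  then have w': "0 < Re w \<or> w = 0" by simp
  have p: "p > 0" "1 \<le> p" by (auto simp: p_def add_pos_nonneg)
  have q: "q > 0" using c p by (simp add: q_def)
  have q1: "q \<le> cmod (w\<^sup>2 + 1)"
    using norm_one_plus_square_ge[of c w] c w by (simp add: q_def p_def r_def)
  have zb: "0 \<le> Re z" using norm_exp_arsinh(3)[OF w'] by (simp add: z_def)
  have z_lower: "r \<le> cmod z * sqrt p"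
    using norm_le_norm_arsinh[OF w'] by (simp add: z_def p_def r_def)
  have z0: "z \<noteq> 0" using z_lower r by auto
  have z1: "1 + z \<noteq> 0" using zb by (auto simp: complex_eq_iff)
  define X where "X = cmod (z / (1 + z))"
  have X0: "X > 0" using z0 z1 by (simp add: X_def)
  have E: "cmod (E 3 \<alpha> \<beta> z) = X powr (\<alpha> - 1) * exp (- \<beta> * Re z)"
    by (simp add: E_def norm_mult norm_powr_real_powr' X_def)
  \<comment> \<open>Here |exp z|^2 >= |w|^2 + |w^2 + 1| >= q; the term |w|^2 is given away.\<close>
  have expb: "exp (- \<beta> * Re z) \<le> q powr (- (\<beta> / 2))"
  proof -
    have "exp (- \<beta> * Re z) = ((cmod (exp z)) powr 2) powr (- (\<beta> / 2))"
      unfolding powr_powr by (simp add: powr_def)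
    also have "(cmod (exp z)) powr 2 = (cmod (exp z))\<^sup>2"
      by (simp only: powr_numeral norm_ge_zero)
    also have "\<dots> powr (- (\<beta> / 2)) \<le> q powr (- (\<beta> / 2))"
    proof (rule powr_mono2')
      have "q \<le> (cmod w)\<^sup>2 + cmod (w\<^sup>2 + 1)" using q1 by (simp add: add_increasing)
      also have "\<dots> \<le> (cmod (exp z))\<^sup>2" using norm_exp_arsinh(1)[OF w'] by (simp add: z_def)
      finally show "q \<le> (cmod (exp z))\<^sup>2" .
    qed (use ab q in auto)
    finally show ?thesis .
  qed
  have db: "cmod (w / csqrt (w\<^sup>2 + 1)) \<le> r * q powr (- (1 / 2))"
  proof -
    have "cmod (w / csqrt (w\<^sup>2 + 1)) = r / sqrt (cmod (w\<^sup>2 + 1))"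
      by (simp add: norm_divide r_def)
    also have "\<dots> \<le> r / sqrt q"
      using r q q1 by (intro frac_le) auto
    also have "\<dots> = r * q powr (- (1 / 2))"
      using q by (simp add: powr_minus_divide powr_half_sqrt)
    finally show ?thesis .
  qed
  define H where "H = 2 powr ((1 - \<alpha> + \<bar>1 - \<alpha>\<bar>) / 2) * c powr (- ((max \<alpha> 1 + \<beta>) / 2))
        * (r powr \<alpha> * p powr (- ((\<alpha> + \<beta>) / 2)))"
  \<comment> \<open>Only the factor X^(\<alpha> - 1) depends on the sign of \<alpha> - 1, so its
    bound \<open>Y\<close> is left open for the two cases.\<close>
  have goal: "cmod (E 3 \<alpha> \<beta> z) * cmod (w / csqrt (w\<^sup>2 + 1)) \<le> Y * q powr (- (\<beta> / 2)) * (r * q powr (- (1 / 2)))"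
    if "X powr (\<alpha> - 1) \<le> Y" for Y
  proof -
    have "0 \<le> Y" using that powr_ge_zero[of X "\<alpha> - 1"] by linarith
    then show ?thesis
      unfolding E using that expb db r by (intro mult_mono mult_nonneg_nonneg) auto
  qed
  have "cmod (E 3 \<alpha> \<beta> z) * cmod (w / csqrt (w\<^sup>2 + 1)) \<le> H"
  proof (cases "1 \<le> \<alpha>")
    case True
    \<comment> \<open>Uses c |z|^2 <= r^2 and, since Re z >= 0, also |1 + z|^2 >= 1 + |z|^2.\<close>
    have X2: "X\<^sup>2 \<le> r\<^sup>2 / q"
    proof -
      have "cmod z \<le> r / sqrt c" using norm_arsinh_le[OF c w(1)] by (simp add: z_def r_def)
      then have "(cmod z)\<^sup>2 \<le> (r / sqrt c)\<^sup>2" by (rule power_mono) simp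
      then have zc: "c * (cmod z)\<^sup>2 \<le> r\<^sup>2" using c by (simp add: power_divide field_simps)
      have n1: "1 + (cmod z)\<^sup>2 \<le> (cmod (1 + z))\<^sup>2"
        unfolding cmod_power2 using zb by (simp add: power2_eq_square algebra_simps)
      have "(cmod z)\<^sup>2 * q = c * (cmod z)\<^sup>2 + c * ((cmod z)\<^sup>2 * r\<^sup>2)"
        by (simp add: q_def p_def algebra_simps)
      also have "\<dots> \<le> r\<^sup>2 + 1 * ((cmod z)\<^sup>2 * r\<^sup>2)"
        using zc c by (intro add_mono mult_right_mono) auto
      also have "\<dots> = r\<^sup>2 * (1 + (cmod z)\<^sup>2)" by (simp add: algebra_simps)
      also have "\<dots> \<le> r\<^sup>2 * (cmod (1 + z))\<^sup>2" by (intro mult_left_mono n1) simp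
      finally have "(cmod z)\<^sup>2 * q \<le> r\<^sup>2 * (cmod (1 + z))\<^sup>2" .
      then show ?thesis using q z1 by (simp add: X_def norm_divide power_divide divide_simps)
    qed
    have half: "2 * ((\<alpha> - 1) / 2) = \<alpha> - 1" by (simp add: field_simps)
    have "X powr (\<alpha> - 1) = (X powr 2) powr ((\<alpha> - 1) / 2)"
      unfolding powr_powr half ..
    also have "X powr 2 = X\<^sup>2" using X0 by simp
    also have "(X\<^sup>2) powr ((\<alpha> - 1) / 2) \<le> (r\<^sup>2 / q) powr ((\<alpha> - 1) / 2)"
      using X2 True by (intro powr_mono2) auto
    also have "\<dots> = (r powr 2) powr ((\<alpha> - 1) / 2) / q powr ((\<alpha> - 1) / 2)"
      using r q by (simp add: powr_divide)
    also have "\<dots> = r powr (\<alpha> - 1) * q powr (- ((\<alpha> - 1) / 2))"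
      unfolding powr_powr half powr_minus_divide by simp
    finally have "X powr (\<alpha> - 1) \<le> r powr (\<alpha> - 1) * q powr (- ((\<alpha> - 1) / 2))" .
    from goal[OF this]
    have "cmod (E 3 \<alpha> \<beta> z) * cmod (w / csqrt (w\<^sup>2 + 1))
       \<le> (r powr (\<alpha> - 1) * r) * (q powr (- ((\<alpha> - 1) / 2)) * q powr (- (\<beta> / 2)) * q powr (- (1 / 2)))"
      by (simp only: mult_ac)
    also have "r powr (\<alpha> - 1) * r = r powr \<alpha>" using r by (simp add: powr_diff)
    also have "q powr (- ((\<alpha> - 1) / 2)) * q powr (- (\<beta> / 2)) * q powr (- (1 / 2)) = q powr (- ((\<alpha> + \<beta>) / 2))"
      unfolding powr_add[symmetric] by (rule arg_cong[where f = "\<lambda>x. q powr x"]) (simp add: field_simps)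
    also have "\<dots> = c powr (- ((\<alpha> + \<beta>) / 2)) * p powr (- ((\<alpha> + \<beta>) / 2))"
      using c p by (simp add: q_def powr_mult)
    finally show ?thesis using True by (simp add: H_def mult_ac max_def)
  next
    case False
    \<comment> \<open>Both summands of |1 + z| r <= r + |z| r are at most |z| sqrt p, the first by
      the lower bound for |z|.\<close>
    have Xl: "r / (2 * sqrt p) \<le> X"
    proof -
      have "r \<le> sqrt p" using r by (intro real_le_rsqrt) (simp add: p_def)
      have "cmod (1 + z) * r \<le> (1 + cmod z) * r"
        using norm_triangle_ineq[of 1 z] r by (intro mult_right_mono) auto
      also have "\<dots> = r + cmod z * r" by (simp add: algebra_simps)
      also have "\<dots> \<le> cmod z * sqrt p + cmod z * sqrt p"
        using z_lower \<open>r \<le> sqrt p\<close> by (intro add_mono mult_left_mono) auto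
      also have "\<dots> = cmod z * (2 * sqrt p)" by (simp add: algebra_simps)
      finally have "cmod (1 + z) * r \<le> cmod z * (2 * sqrt p)" .
      then show ?thesis using z1 p by (simp add: X_def norm_divide divide_simps mult_ac)
    qed
    have "X powr (\<alpha> - 1) \<le> (r / (2 * sqrt p)) powr (\<alpha> - 1)"
      using False Xl r p by (intro powr_mono2') auto
    also have "\<dots> = r powr (\<alpha> - 1) / (2 powr (\<alpha> - 1) * (p powr (1 / 2)) powr (\<alpha> - 1))"
      using r p by (simp add: powr_divide powr_mult powr_half_sqrt)
    also have "\<dots> = r powr (\<alpha> - 1) * (2 powr (1 - \<alpha>) * p powr ((1 - \<alpha>) / 2))"
    proof -
      have "2 powr (1 - \<alpha>) = 1 / 2 powr (\<alpha> - 1)"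
        unfolding powr_minus_divide[symmetric] by simp
      moreover have "p powr ((1 - \<alpha>) / 2) = 1 / (p powr (1/2)) powr (\<alpha> - 1)"
        unfolding powr_powr powr_minus_divide[symmetric]
        by (rule arg_cong[where f = "\<lambda>x. p powr x"]) (simp add: field_simps)
      ultimately show ?thesis by simp
    qed
    finally have "X powr (\<alpha> - 1) \<le> r powr (\<alpha> - 1) * (2 powr (1 - \<alpha>) * p powr ((1 - \<alpha>) / 2))" .
    from goal[OF this]
    have "cmod (E 3 \<alpha> \<beta> z) * cmod (w / csqrt (w\<^sup>2 + 1))
       \<le> (r powr (\<alpha> - 1) * r) * 2 powr (1 - \<alpha>) * p powr ((1 - \<alpha>) / 2) * (q powr (- (\<beta> / 2)) * q powr (- (1 / 2)))"
      by (simp only: mult_ac)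
    also have "r powr (\<alpha> - 1) * r = r powr \<alpha>" using r by (simp add: powr_diff)
    also have "q powr (- (\<beta> / 2)) * q powr (- (1 / 2)) = q powr (- ((1 + \<beta>) / 2))"
      unfolding powr_add[symmetric] by (rule arg_cong[where f = "\<lambda>x. q powr x"]) (simp add: field_simps)
    also have "\<dots> = c powr (- ((1 + \<beta>) / 2)) * p powr (- ((1 + \<beta>) / 2))"
      using c p by (simp add: q_def powr_mult)
    also have "r powr \<alpha> * 2 powr (1 - \<alpha>) * p powr ((1 - \<alpha>) / 2) * (c powr (- ((1 + \<beta>) / 2)) * p powr (- ((1 + \<beta>) / 2)))
       = 2 powr (1 - \<alpha>) * c powr (- ((1 + \<beta>) / 2)) * (r powr \<alpha> * (p powr ((1 - \<alpha>) / 2) * p powr (- ((1 + \<beta>) / 2))))"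
      by (simp only: mult_ac)
    also have "p powr ((1 - \<alpha>) / 2) * p powr (- ((1 + \<beta>) / 2)) = p powr (- ((\<alpha> + \<beta>) / 2))"
      unfolding powr_add[symmetric] by (rule arg_cong[where f = "\<lambda>x. p powr x"]) (simp add: field_simps)
    also have "1 - \<alpha> = (1 - \<alpha> + \<bar>1 - \<alpha>\<bar>) / 2" using False by (simp add: field_simps)
    also have "(1 + \<beta>) / 2 = (max \<alpha> 1 + \<beta>) / 2" using False by simp
    finally show ?thesis unfolding H_def .
  qed
  then show ?thesis by (simp only: H_def z_def r_def p_def)
qed

text \<open>The estimate for E_3 is sharper than the constant in C_3, so this comparison is crude.
  For \<alpha> < 1 the surplus (1/cos d)^((1 - \<alpha>)/2) is absorbed by
  \<open>c_ad\<close>.\<close>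

lemma envelope_constant_le:
  assumes d: "0 < d" "d < pi / 2" and ab: "0 < \<alpha>" "0 < \<beta>"
  shows "2 powr ((1 - \<alpha> + \<bar>1 - \<alpha>\<bar>) / 2) * cos d powr (- ((max \<alpha> 1 + \<beta>) / 2))
     \<le> 2 powr (1 + \<beta> / 2) * c_ad \<alpha> d / cos d powr ((\<alpha> + \<beta>) / 2)"
proof -
  define c where "c = cos d"
  have c: "0 < c" "c \<le> 1" using d cos_gt_zero[of d] by (auto simp: c_def)
  show ?thesis
  proof (cases "\<alpha> < 1")
    case False
    have "1 * 1 \<le> 2 powr (1 + \<beta> / 2) * c_ad \<alpha> d"
      using False ab by (intro mult_mono) (auto simp: c_ad_def intro!: ge_one_powr_ge_zero)
    then have "1 / c powr ((\<alpha> + \<beta>) / 2) \<le> 2 powr (1 + \<beta> / 2) * c_ad \<alpha> d / c powr ((\<alpha> + \<beta>) / 2)"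
      by (intro divide_right_mono) auto
    then show ?thesis using False by (simp add: c_def powr_minus_divide max_def)
  next
    case True
    have e: "(1 - \<alpha> + \<bar>1 - \<alpha>\<bar>) / 2 = 1 - \<alpha>" using True by (simp add: field_simps)
    have "c powr (- ((max \<alpha> 1 + \<beta>) / 2)) = c powr (- ((1 - \<alpha>) / 2)) * c powr (- ((\<alpha> + \<beta>) / 2))"
      unfolding powr_add[symmetric] using True by (intro arg_cong[where f = "\<lambda>x. c powr x"]) (simp add: field_simps)
    also have "c powr (- ((1 - \<alpha>) / 2)) = (1 / c) powr ((1 - \<alpha>) / 2)"
      using c by (simp add: powr_minus_divide powr_divide)
    finally have "2 powr ((1 - \<alpha> + \<bar>1 - \<alpha>\<bar>) / 2) * c powr (- ((max \<alpha> 1 + \<beta>) / 2))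
       = 2 powr (1 - \<alpha>) * (1 / c) powr ((1 - \<alpha>) / 2) / c powr ((\<alpha> + \<beta>) / 2)"
      unfolding e by (simp add: powr_minus_divide)
    also have "\<dots> \<le> 2 powr (1 + \<beta> / 2) * c_ad \<alpha> d / c powr ((\<alpha> + \<beta>) / 2)"
    proof (intro divide_right_mono mult_mono)
      show "2 powr (1 - \<alpha>) \<le> (2::real) powr (1 + \<beta> / 2)" using ab by (intro powr_mono) auto
      show "(1 / c) powr ((1 - \<alpha>) / 2) \<le> c_ad \<alpha> d"
      proof -
        have "1 / c \<le> 2 * (1 + 1 / c)" using c by (simp add: field_simps)
        then have "(1 / c) powr ((1 - \<alpha>) / 2) \<le> (2 * (1 + 1 / c)) powr ((1 - \<alpha>) / 2)"
          using True c by (intro powr_mono2) auto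
        then show ?thesis using True by (simp add: c_ad_def c_def)
      qed
    qed auto
    finally show ?thesis by (simp only: c_def)
  qed
qed

text \<open>The choice of h makes pi d / h = \<mu> n h = \<sigma>; the conditions on M and N say
  that both cut-offs reach at least this exponent.\<close>

lemma error_constants_le:
  fixes n :: nat and M N :: int
  assumes pos: "0 < d" "0 < \<mu>" "0 < n" "0 \<le> K" "0 \<le> A" "0 \<le> B" and h: "h = sqrt (pi * d / (\<mu> * real n))"
    and ab: "\<mu> \<le> \<alpha>" "\<mu> \<le> \<beta>" and M: "\<mu> * real n \<le> \<alpha> * real_of_int M" and N: "\<mu> * real n \<le> \<beta> * real_of_int N"
  shows "K * A * (1 / \<alpha> + 1 / \<beta>) * (h / d) / sinh (pi * d / h) / pi
      + 1.1 * (K * B) * (exp (- \<alpha> * (real_of_int M * h)) / \<alpha> + exp (- \<beta> * (real_of_int N * h)) / \<beta>)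
     \<le> 2 * K / \<mu> * (A / (1 - exp (- 2 * sqrt (pi * d * \<mu>))) * sqrt (pi / (d * \<mu>)) + 1.1 * B)
        * exp (- sqrt (pi * d * \<mu> * real n))"
proof -
  define \<sigma> where "\<sigma> = sqrt (pi * d * \<mu> * real n)"
  define \<sigma>1 where "\<sigma>1 = sqrt (pi * d * \<mu>)"
  have hpos: "h > 0" using pos by (simp add: h)
  have \<sigma>1: "0 < \<sigma>1" "\<sigma>1 \<le> \<sigma>"
    using pos by (auto simp: \<sigma>_def \<sigma>1_def)
  have \<sigma>h: "\<sigma> * h = pi * d" "\<mu> * real n * h = \<sigma>"
  proof -
    have "\<sigma> * h = sqrt ((pi * d * \<mu> * real n) * (pi * d / (\<mu> * real n)))"
      unfolding \<sigma>_def h real_sqrt_mult ..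
    also have "(pi * d * \<mu> * real n) * (pi * d / (\<mu> * real n)) = (pi * d)\<^sup>2"
      using pos by (simp add: power2_eq_square)
    finally show "\<sigma> * h = pi * d" using pos by simp
    have "\<mu> * real n * h = sqrt ((\<mu> * real n)\<^sup>2) * h" using pos by simp
    also have "\<dots> = sqrt ((\<mu> * real n)\<^sup>2 * (pi * d / (\<mu> * real n)))"
      unfolding h real_sqrt_mult ..
    also have "(\<mu> * real n)\<^sup>2 * (pi * d / (\<mu> * real n)) = pi * d * \<mu> * real n"
      using pos by (simp add: power2_eq_square)
    finally show "\<mu> * real n * h = \<sigma>" by (simp only: \<sigma>_def)
  qed
  have pdh: "pi * d / h = \<sigma>" using \<sigma>h(1) hpos by (simp add: field_simps)
  have \<mu>ab: "1 / \<alpha> + 1 / \<beta> \<le> 2 / \<mu>"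
  proof -
    have "1 / \<alpha> \<le> 1 / \<mu>" "1 / \<beta> \<le> 1 / \<mu>" using pos ab by (auto intro!: divide_left_mono mult_pos_pos)
    then show ?thesis by simp
  qed
  \<comment> \<open>\<open>\<sigma>1\<close> is \<sigma> at n = 1. Replacing \<sigma> by it here,
    and likewise n by 1 in h/d below, makes the constant independent of n.\<close>
  define q where "q = 1 - exp (- 2 * \<sigma>1)"
  have q: "0 < q" using \<sigma>1 by (simp add: q_def)
  have hd: "h / d \<le> sqrt (pi / (d * \<mu>))"
  proof -
    have "h / d = sqrt (pi * d / (\<mu> * real n)) / sqrt (d\<^sup>2)" using pos by (simp add: h)
    also have "\<dots> = sqrt (pi * d / (\<mu> * real n) / d\<^sup>2)" by (rule real_sqrt_divide[symmetric])
    also have "\<dots> \<le> sqrt (pi / (d * \<mu>))"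
    proof (rule real_sqrt_le_mono)
      have "pi * d / (\<mu> * real n) / d\<^sup>2 = pi / (d * \<mu>) / real n"
        using pos by (simp add: field_simps power2_eq_square)
      also have "\<dots> \<le> pi / (d * \<mu>) / 1" using pos by (intro divide_left_mono) auto
      finally show "pi * d / (\<mu> * real n) / d\<^sup>2 \<le> pi / (d * \<mu>)" by simp
    qed
    finally show ?thesis .
  qed
  have sinh: "1 / sinh \<sigma> \<le> 2 * exp (- \<sigma>) / q"
  proof -
    have "sinh \<sigma> = exp \<sigma> * (1 - exp (- 2 * \<sigma>)) / 2"
      by (simp add: sinh_field_def right_diff_distrib flip: exp_add)
    moreover have "q \<le> 1 - exp (- 2 * \<sigma>)" using \<sigma>1 by (simp add: q_def)
    ultimately have "exp \<sigma> * q / 2 \<le> sinh \<sigma>" by (simp add: divide_right_mono)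
    then have "1 / sinh \<sigma> \<le> 1 / (exp \<sigma> * q / 2)" using q by (intro divide_left_mono) (auto intro!: mult_pos_pos simp: \<sigma>1 less_le_trans[OF \<sigma>1])
    then show ?thesis by (simp add: exp_minus field_simps)
  qed
  have sinh0: "0 < sinh \<sigma>" using \<sigma>1 by simp
  have "K * A * (1 / \<alpha> + 1 / \<beta>) * (h / d) / sinh (pi * d / h) / pi
     = K * A * (1 / \<alpha> + 1 / \<beta>) * (h / d) * (1 / sinh \<sigma>) * (1 / pi)" by (simp add: pdh)
  \<comment> \<open>The factor 1/pi is weakened to 1/2, which meets the 2 from 1/sinh and leaves the
    2K/\<mu> of the theorem.\<close>
  also have "\<dots> \<le> K * A * (2 / \<mu>) * sqrt (pi / (d * \<mu>)) * (2 * exp (- \<sigma>) / q) * (1 / 2)"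
    using pos \<mu>ab hd sinh sinh0 hpos q ab pi_gt3
    by (intro mult_mono mult_nonneg_nonneg add_nonneg_nonneg divide_left_mono) auto
  also have "\<dots> = 2 * K / \<mu> * (A / q * sqrt (pi / (d * \<mu>))) * exp (- \<sigma>)" by simp
  finally have 1: "K * A * (1 / \<alpha> + 1 / \<beta>) * (h / d) / sinh (pi * d / h) / pi
     \<le> 2 * K / \<mu> * (A / q * sqrt (pi / (d * \<mu>))) * exp (- \<sigma>)" .
  have ex: "exp (- \<gamma> * (real_of_int L * h)) / \<gamma> \<le> exp (- \<sigma>) * (1 / \<mu>)"
    if "\<mu> \<le> \<gamma>" "\<mu> * real n \<le> \<gamma> * real_of_int L" for \<gamma> L
  proof -
    have "\<sigma> \<le> \<gamma> * real_of_int L * h" using mult_right_mono[OF that(2), of h] hpos \<sigma>h(2) by simp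
    then have "exp (- \<gamma> * (real_of_int L * h)) \<le> exp (- \<sigma>)" by (simp add: mult.assoc)
    moreover have "1 / \<gamma> \<le> 1 / \<mu>" using that pos by (intro divide_left_mono) auto
    ultimately have "exp (- \<gamma> * (real_of_int L * h)) * (1 / \<gamma>) \<le> exp (- \<sigma>) * (1 / \<mu>)"
      using that pos by (intro mult_mono) auto
    then show ?thesis by simp
  qed
  have "1.1 * (K * B) * (exp (- \<alpha> * (real_of_int M * h)) / \<alpha> + exp (- \<beta> * (real_of_int N * h)) / \<beta>)
     \<le> 1.1 * (K * B) * (exp (- \<sigma>) * (1 / \<mu>) + exp (- \<sigma>) * (1 / \<mu>))"
    using pos by (intro mult_left_mono add_mono ex ab M N) auto
  also have "\<dots> = 2 * K / \<mu> * (1.1 * B) * exp (- \<sigma>)" by simp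
  finally have 2: "1.1 * (K * B) * (exp (- \<alpha> * (real_of_int M * h)) / \<alpha> + exp (- \<beta> * (real_of_int N * h)) / \<beta>)
     \<le> 2 * K / \<mu> * (1.1 * B) * exp (- \<sigma>)" .
  have "2 * K / \<mu> * (A / q * sqrt (pi / (d * \<mu>))) * exp (- \<sigma>) + 2 * K / \<mu> * (1.1 * B) * exp (- \<sigma>)
     = 2 * K / \<mu> * (A / q * sqrt (pi / (d * \<mu>)) + 1.1 * B) * exp (- \<sigma>)"
    by (simp only: distrib_left distrib_right)
  then show ?thesis using add_mono[OF 1 2] by (simp only: q_def \<sigma>_def \<sigma>1_def)
qed

subsection \<open>Change of variables\<close>

text \<open>For \<alpha> < 1 the majorant permits a singularity at 0, so continuity is asked only
  off 0 and integrability comes from domination by t^(\<alpha> - 1). The value at 0 is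
  irrelevant.\<close>

lemma integrable_on_powr_bound:
  fixes f :: "real \<Rightarrow> complex"
  assumes \<tau>: "0 < \<tau>" and cont: "continuous_on {0<..\<tau>} f" and \<alpha>: "0 < \<alpha>"
    and bd: "\<And>t. t \<in> {0<..\<tau>} \<Longrightarrow> cmod (f t) \<le> C * t powr (\<alpha> - 1)"
  shows "f integrable_on {0..\<tau>}"
proof -
  have neg: "negligible {0::real}" by simp
  have "(\<lambda>t. C * t powr (\<alpha> - 1)) integrable_on {0..\<tau>}"
    using has_integral_powr_from_0[of "\<alpha> - 1" \<tau>] \<alpha> \<tau>
    by (intro integrable_on_mult_right) (auto simp: integrable_on_def)
  then have "(\<lambda>t. C * t powr (\<alpha> - 1)) integrable_on {0<..\<tau>}"
    by (rule integrable_spike_set) (auto intro: negligible_subset[OF neg])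
  moreover have "{0<..\<tau>} \<in> sets lebesgue" by auto
  moreover from this have "f \<in> borel_measurable (lebesgue_on {0<..\<tau>})"
    by (intro continuous_imp_measurable_on_sets_lebesgue cont)
  ultimately have "f integrable_on {0<..\<tau>}"
    using bd measurable_bounded_by_integrable_imp_integrable[of f "{0<..\<tau>}" "\<lambda>t. C * t powr (\<alpha> - 1)"] by blast
  then show ?thesis
    by (rule integrable_spike_set) (auto intro: negligible_subset[OF neg])
qed

text \<open>On [a, \<xi>] the image under g avoids the possible singularity at 0, so ordinary
  substitution applies. The missing piece from 0 to g(a) vanishes by continuity of the indefinite
  integral.\<close>

lemma improper_substitution_tendsto:
  fixes f :: "real \<Rightarrow> complex" and g g' :: "real \<Rightarrow> real"
  assumes f: "f integrable_on {0..g \<xi>}" and cont: "continuous_on {0<..} f"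
    and g: "\<And>x. (g has_real_derivative g' x) (at x)" "\<And>x. 0 < g x" "mono g"
    and lim: "(g \<longlongrightarrow> 0) at_bot"
  shows "((\<lambda>a. integral {a..\<xi>} (\<lambda>x. f (g x) * of_real (g' x))) \<longlongrightarrow> integral {0..g \<xi>} f) at_bot"
proof -
  have "continuous_on {0..g \<xi>} (\<lambda>x. integral {0..x} f)"
    by (rule indefinite_integral_continuous_1[OF f])
  then have "((\<lambda>x. integral {0..x} f) \<longlongrightarrow> integral {0..0} f) (at 0 within {0..g \<xi>})"
    using continuous_on_def[THEN iffD1, THEN bspec, of "{0..g \<xi>}" "\<lambda>x. integral {0..x} f" 0] g(2)[of \<xi>]
    by simp
  moreover have "filterlim g (at 0 within {0..g \<xi>}) at_bot"
    unfolding filterlim_at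
  proof (intro conjI lim)
    show "\<forall>\<^sub>F x in at_bot. g x \<in> {0..g \<xi>} \<and> g x \<noteq> 0"
      using eventually_le_at_bot[of \<xi>]
      by eventually_elim (use g(2) monoD[OF g(3)] in \<open>auto simp: less_imp_le less_imp_neq[symmetric]\<close>)
  qed
  ultimately have "((\<lambda>a. integral {0..g a} f) \<longlongrightarrow> integral {0..0} f) at_bot"
    by (rule filterlim_compose)
  then have "((\<lambda>a. integral {0..g \<xi>} f - integral {0..g a} f) \<longlongrightarrow> integral {0..g \<xi>} f - 0) at_bot"
    by (intro tendsto_intros) simp
  moreover have "\<forall>\<^sub>F a in at_bot. integral {0..g \<xi>} f - integral {0..g a} f = integral {a..\<xi>} (\<lambda>x. f (g x) * of_real (g' x))"
    using eventually_le_at_bot[of \<xi>]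
  proof eventually_elim
    case (elim a)
    have "((\<lambda>x. g' x *\<^sub>R f (g x)) has_integral (integral {g a..g \<xi>} f)) {a..\<xi>}"
    proof (rule has_integral_substitution[OF elim, of g "g a" "g \<xi>"])
      show "g a \<le> g \<xi>" using elim g(3) by (rule monoD[rotated])
      show "g ` {a..\<xi>} \<subseteq> {g a..g \<xi>}" by (auto simp: monoD[OF g(3)])
      show "continuous_on {g a..g \<xi>} f"
        using g(2)[of a] by (intro continuous_on_subset[OF cont]) auto
    qed (use g(1) in \<open>auto intro: has_field_derivative_at_within\<close>)
    then have "integral {a..\<xi>} (\<lambda>x. f (g x) * of_real (g' x)) = integral {g a..g \<xi>} f"
      by (simp add: integral_unique scaleR_conv_of_real mult.commute)
    moreover have "integral {0..g a} f + integral {g a..g \<xi>} f = integral {0..g \<xi>} f"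
      using g(2)[of a] monoD[OF g(3) elim] by (intro Henstock_Kurzweil_Integration.integral_combine f) auto
    ultimately show ?case by (simp add: algebra_simps)
  qed
  ultimately show ?thesis by (auto intro: Lim_transform_eventually)
qed

section \<open>The maps psi on the strip and on the real line\<close>

lemma strip_sector:
  assumes "0 < d" "d < pi / 2" "\<zeta> \<in> strip d"
  shows "cos d * cmod (exp \<zeta>) \<le> Re (exp \<zeta>)"
proof -
  have "cos d \<le> cos \<bar>Im \<zeta>\<bar>"
    using assms by (intro cos_monotone_0_pi_le) (auto simp: strip_def)
  then have "cos d \<le> cos (Im \<zeta>)" by simp
  then show ?thesis by (simp add: Re_exp mult.commute)
qed

lemma csqrt_exp_of_real: "csqrt ((exp (of_real x))\<^sup>2 + 1) = of_real (sqrt ((exp x)\<^sup>2 + 1))"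
proof -
  have "(exp (complex_of_real x))\<^sup>2 + 1 = of_real ((exp x)\<^sup>2 + 1)" by (simp add: exp_of_real)
  moreover have "0 \<le> (exp x)\<^sup>2 + 1" by simp
  ultimately show ?thesis by (metis of_real_sqrt)
qed

lemma psiR_properties:
  assumes "i \<in> {2, 3}"
  shows "(psiR i has_real_derivative (if i = 2 then exp x else exp x / sqrt ((exp x)\<^sup>2 + 1))) (at x)"
    and "0 < psiR i x" and "strict_mono (psiR i)" and "(psiR i \<longlongrightarrow> 0) at_bot"
    and "0 < \<tau> \<Longrightarrow> \<exists>\<xi>. psiR i \<xi> = \<tau>"
    and "psiC i (of_real x) = of_real (psiR i x)"
proof -
  have p2: "psiR 2 = exp" by (simp add: psiR_def[abs_def])
  have p3: "psiR 3 = (\<lambda>t. arsinh (exp t))" by (simp add: psiR_def[abs_def])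
  show "(psiR i has_real_derivative (if i = 2 then exp x else exp x / sqrt ((exp x)\<^sup>2 + 1))) (at x)"
    using assms DERIV_chain2[OF arsinh_real_has_field_derivative DERIV_exp, of x] DERIV_exp[of x]
    by (auto simp: p2 p3)
  show "0 < psiR i x" by (simp add: psiR_def)
  show "strict_mono (psiR i)" by (rule strict_monoI) (simp add: psiR_def)
  show "(psiR i \<longlongrightarrow> 0) at_bot"
  proof (cases "i = 2")
    case False
    then have "psiR i = (\<lambda>t. arsinh (exp t))" using assms p3 by auto
    moreover have "((\<lambda>t. arsinh (exp t)) \<longlongrightarrow> arsinh (0::real)) at_bot"
      by (intro tendsto_arsinh exp_at_bot)
    ultimately show ?thesis by simp
  qed (use exp_at_bot in \<open>simp add: p2\<close>)
  show "\<exists>\<xi>. psiR i \<xi> = \<tau>" if "0 < \<tau>"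
  proof (cases "i = 2")
    case True
    then show ?thesis using that by (auto simp: p2 intro!: exI[of _ "ln \<tau>"])
  next
    case False
    then show ?thesis using that by (auto simp: psiR_def arsinh_sinh_real intro!: exI[of _ "ln (sinh \<tau>)"])
  qed
  show "psiC i (of_real x) = of_real (psiR i x)"
  proof (cases "i = 2")
    case False
    have "arsinh (exp (complex_of_real x)) = Ln (of_real (exp x + sqrt ((exp x)\<^sup>2 + 1)))"
      by (simp add: arsinh_complex_def csqrt_exp_of_real exp_of_real)
    also have "\<dots> = of_real (arsinh (exp x))"
      by (subst Ln_of_real) (auto simp: arsinh_real_def add_pos_pos)
    finally show ?thesis using False by (simp add: psiC_def psiR_def)
  qed (simp add: psiC_def psiR_def exp_of_real)
qed

subsection \<open>The error bound\<close>

text \<open>Needed only for integrability near 0, so the constant may depend on \<tau>; it is not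
  part of the final bound.\<close>

lemma norm_E_of_real_le:
  assumes i: "i \<in> {2, 3}" and t: "0 < t" "t \<le> \<tau>" and ab: "0 < \<alpha>" "0 < \<beta>"
  shows "cmod (E i \<alpha> \<beta> (of_real t)) \<le> (1 + \<tau>) powr \<bar>1 - \<alpha>\<bar> * t powr (\<alpha> - 1)"
proof -
  have a: "cmod (complex_of_real x powr of_real y) = x powr y" if "0 \<le> x" for x y
    using that norm_powr_real_powr'[of "of_real y" "of_real x"] by simp
  show ?thesis
  proof (cases "i = 2")
    case True
    have eq: "1 + (complex_of_real t)\<^sup>2 = of_real (1 + t\<^sup>2)" by simp
    have "cmod (E i \<alpha> \<beta> (of_real t)) = t powr (\<alpha> - 1) * (1 + t\<^sup>2) powr (- (\<alpha> + \<beta>) / 2)"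
      unfolding E_def eq norm_mult if_P[OF True] using t by (subst (1 2) a) auto
    also have "\<dots> \<le> t powr (\<alpha> - 1) * 1"
    proof (rule mult_left_mono)
      have "(1 + t\<^sup>2) powr (- (\<alpha> + \<beta>) / 2) \<le> 1 powr (- (\<alpha> + \<beta>) / 2)"
        using ab by (intro powr_mono2') auto
      then show "(1 + t\<^sup>2) powr (- (\<alpha> + \<beta>) / 2) \<le> 1" by simp
    qed simp
    also have "\<dots> \<le> t powr (\<alpha> - 1) * (1 + \<tau>) powr \<bar>1 - \<alpha>\<bar>"
      using t by (intro mult_left_mono ge_one_powr_ge_zero) auto
    finally show ?thesis by (simp only: mult.commute)
  next
    case False
    have eq: "complex_of_real t / (1 + of_real t) = of_real (t / (1 + t))" by simp
    have "cmod (E i \<alpha> \<beta> (of_real t)) = (t / (1 + t)) powr (\<alpha> - 1) * exp (- \<beta> * t)"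
      unfolding E_def eq norm_mult if_not_P[OF False] using t by (subst a) auto
    also have "\<dots> \<le> (t / (1 + t)) powr (\<alpha> - 1) * 1"
      using t ab by (intro mult_left_mono) auto
    also have "(t / (1 + t)) powr (\<alpha> - 1) * 1 = t powr (\<alpha> - 1) * (1 + t) powr (1 - \<alpha>)"
    proof -
      have "(1 + t) powr (1 - \<alpha>) = 1 / (1 + t) powr (\<alpha> - 1)"
        unfolding powr_minus_divide[symmetric] by simp
      then show ?thesis using t by (simp add: powr_divide)
    qed
    also have "\<dots> \<le> t powr (\<alpha> - 1) * (1 + \<tau>) powr \<bar>1 - \<alpha>\<bar>"
    proof (rule mult_left_mono)
      have "(1 + t) powr (1 - \<alpha>) \<le> (1 + t) powr \<bar>1 - \<alpha>\<bar>" using t by (intro powr_mono) auto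
      also have "\<dots> \<le> (1 + \<tau>) powr \<bar>1 - \<alpha>\<bar>" using t by (intro powr_mono2) auto
      finally show "(1 + t) powr (1 - \<alpha>) \<le> (1 + \<tau>) powr \<bar>1 - \<alpha>\<bar>" .
    qed simp
    finally show ?thesis by (simp only: mult.commute)
  qed
qed

text \<open>A closed form, so that holomorphy and moduli can be read off; on the real line it agrees
  with \<open>deriv (psiR i)\<close>.\<close>

definition psiC' :: "nat \<Rightarrow> complex \<Rightarrow> complex" where
  "psiC' i z = (if i = 2 then exp z else exp z / csqrt ((exp z)\<^sup>2 + 1))"

lemma psiC_has_field_derivative:
  assumes "0 < d" "d < pi / 2" "z \<in> strip d"
  shows "(psiC i has_field_derivative psiC' i z) (at z)"
    and "psiC' i field_differentiable at z"
proof -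
  have c: "0 < cos d" using assms by (intro cos_gt_zero) auto
  have "0 < cos d * cmod (exp z)" using c by simp
  also have "\<dots> \<le> Re (exp z)" by (rule strip_sector[OF assms])
  finally have pos: "0 < Re (exp z)" .
  then have p: "0 < Re (exp z) \<or> exp z = 0" by simp
  have "(psiC 2 has_field_derivative exp z) (at z)"
    by (simp add: psiC_def[abs_def])
  moreover have "((\<lambda>z. arsinh (exp z)) has_field_derivative 1 / csqrt ((exp z)\<^sup>2 + 1) * exp z) (at z)"
    by (rule DERIV_chain2[OF has_field_derivative_arsinh_complex[OF p] DERIV_exp])
  ultimately show "(psiC i has_field_derivative psiC' i z) (at z)"
    by (cases "i = 2") (auto simp: psiC_def[abs_def] psiC'_def)
  have n: "(exp z)\<^sup>2 + 1 \<notin> \<real>\<^sub>\<le>\<^sub>0" by (rule square_plus_one_not_nonpos[OF p])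
  have "(\<lambda>z. csqrt ((exp z)\<^sup>2 + 1)) field_differentiable at z"
  proof -
    have "((\<lambda>z. (exp z)\<^sup>2 + 1) has_field_derivative 2 * exp z * exp z) (at z)"
      by (auto intro!: derivative_eq_intros)
    from DERIV_chain2[OF has_field_derivative_csqrt[OF n] this] show ?thesis
      by (auto simp: field_differentiable_def)
  qed
  moreover have "csqrt ((exp z)\<^sup>2 + 1) \<noteq> 0" using n by auto
  ultimately have "(\<lambda>z. exp z / csqrt ((exp z)\<^sup>2 + 1)) field_differentiable at z"
    by (intro field_differentiable_divide field_differentiable_within_exp) auto
  then show "psiC' i field_differentiable at z"
    by (cases "i = 2") (auto simp: psiC'_def[abs_def] field_differentiable_within_exp)
qed

lemma psiC'_of_real:
  assumes "i \<in> {2, 3}"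
  shows "psiC' i (of_real x) = of_real (deriv (psiR i) x)"
  using DERIV_imp_deriv[OF psiR_properties(1)[OF assms, of x]]
  by (simp add: psiC'_def csqrt_exp_of_real exp_of_real)

text \<open>\<open>A\<close> is any majorant of the constant found for the sector, so the larger one
  in C_i for the strip and the sharp one for the real line both fit.\<close>

lemma transformed_integrand_le:
  assumes i: "i \<in> {2, 3}" and pos: "K > 0" "\<alpha> > 0" "\<beta> > 0"
    and f_bd: "\<And>z. z \<in> psiC i ` strip d \<Longrightarrow> cmod (f z) \<le> K * cmod (E i \<alpha> \<beta> z)"
    and z: "z \<in> strip d" and c: "0 < c" "c \<le> 1" "c * cmod (exp z) \<le> Re (exp z)"
    and A: "A \<ge> (if i = 2 then c powr (- ((\<alpha> + \<beta>) / 2))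
                 else 2 powr ((1 - \<alpha> + \<bar>1 - \<alpha>\<bar>) / 2) * c powr (- ((max \<alpha> 1 + \<beta>) / 2)))"
  shows "cmod (f (psiC i z) * psiC' i z) \<le> K * A * exp (\<alpha> * Re z)"
    and "cmod (f (psiC i z) * psiC' i z) \<le> K * A * exp (- \<beta> * Re z)"
proof -
  define w where "w = exp z"
  define v where "v = cmod w powr \<alpha> * (1 + (cmod w)\<^sup>2) powr (- ((\<alpha> + \<beta>) / 2))"
  have w0: "w \<noteq> 0" by (simp add: w_def)
  have v0: "0 \<le> v" by (simp add: v_def)
  have A0: "0 \<le> A" using A by (rule order_trans[rotated]) simp
  have "cmod (E i \<alpha> \<beta> (psiC i z)) * cmod (psiC' i z) \<le> A * v"
  proof (cases "i = 2")
    case True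
    then have "cmod (E i \<alpha> \<beta> (psiC i z)) * cmod (psiC' i z) \<le> c powr (- ((\<alpha> + \<beta>) / 2)) * v"
      using norm_E2_le[OF c(1,2) c(3) _ pos(2,3)] by (simp add: psiC_def psiC'_def v_def w_def)
    also have "\<dots> \<le> A * v" using A True v0 by (intro mult_right_mono) auto
    finally show ?thesis .
  next
    case False
    then have "i = 3" using i by simp
    then have "cmod (E i \<alpha> \<beta> (psiC i z)) * cmod (psiC' i z)
        \<le> 2 powr ((1 - \<alpha> + \<bar>1 - \<alpha>\<bar>) / 2) * c powr (- ((max \<alpha> 1 + \<beta>) / 2)) * v"
      using norm_E3_le[OF c(1,2) c(3) exp_not_eq_zero pos(2,3)]
      by (simp only: psiC_def psiC'_def v_def w_def) simp
    also have "\<dots> \<le> A * v" using A False v0 by (intro mult_right_mono) auto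
    finally show ?thesis .
  qed
  then have "K * (cmod (E i \<alpha> \<beta> (psiC i z)) * cmod (psiC' i z)) \<le> K * (A * v)"
    using pos by (intro mult_left_mono) auto
  moreover have "cmod (f (psiC i z) * psiC' i z) \<le> K * cmod (E i \<alpha> \<beta> (psiC i z)) * cmod (psiC' i z)"
    unfolding norm_mult using z by (intro mult_right_mono f_bd) auto
  ultimately have *: "cmod (f (psiC i z) * psiC' i z) \<le> K * A * v" by (simp add: mult.assoc)
  have "v \<le> exp (\<alpha> * Re z)"
    using envelope_le(1)[of "cmod w" \<alpha> \<beta>] w0 pos by (simp add: v_def w_def exp_powr_real mult.commute)
  then show "cmod (f (psiC i z) * psiC' i z) \<le> K * A * exp (\<alpha> * Re z)"
    using * pos A0 by (intro order_trans[OF *] mult_left_mono) auto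
  have "v \<le> exp (- \<beta> * Re z)"
    using envelope_le(2)[of "cmod w" \<alpha> \<beta>] w0 pos by (simp add: v_def w_def exp_powr_real mult.commute)
  then show "cmod (f (psiC i z) * psiC' i z) \<le> K * A * exp (- \<beta> * Re z)"
    using * pos A0 by (intro order_trans[OF *] mult_left_mono) auto
qed

theorem theorem11:
  fixes i :: nat and d K \<alpha> \<beta> \<mu> h :: real and n :: nat and M N :: int
    and f :: "complex \<Rightarrow> complex"
  assumes i: "i \<in> {2, 3}"
    and d: "0 < d" "d < pi / 2"
    and f_an: "f analytic_on (psiC i ` strip d)"
    and pos: "K > 0" "\<alpha> > 0" "\<beta> > 0"
    and f_bd: "\<And>z. z \<in> psiC i ` strip d \<Longrightarrow> cmod (f z) \<le> K * cmod (E i \<alpha> \<beta> z)"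
    and mu: "\<mu> = min \<alpha> \<beta>"
    and n: "n > 0"
    and h: "h = sqrt (pi * d / (\<mu> * real n))"
    and MNa: "\<mu> = \<alpha> \<Longrightarrow> M = int n \<and> N = \<lceil>\<alpha> * real n / \<beta>\<rceil>"
    and MNb: "\<mu> = \<beta> \<Longrightarrow> N = int n \<and> M = \<lceil>\<beta> * real n / \<alpha>\<rceil>"
  shows "\<forall>\<tau>::real. \<tau> > 0 \<longrightarrow>
           cmod (integral {0..\<tau>} (\<lambda>t. f (of_real t))
                 - (\<Sum>k\<in>{-M..N}. f (of_real (psiR i (real_of_int k * h)))
                        * of_real (deriv (psiR i) (real_of_int k * h))
                        * of_real (J k h (inv (psiR i) \<tau>))))
         \<le> C_const i K \<alpha> \<beta> d * exp (- sqrt (pi * d * \<mu> * real n))"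
proof (intro allI impI)
  fix \<tau> :: real assume \<tau>: "\<tau> > 0"
  obtain \<xi> where \<xi>: "psiR i \<xi> = \<tau>" using psiR_properties(5)[OF i \<tau>] by blast
  have inv: "inv (psiR i) \<tau> = \<xi>"
    using inv_f_f[OF strict_mono_imp_inj_on[OF psiR_properties(3)[OF i]], of \<xi>] \<xi> by simp
  define F where "F z = f (psiC i z) * psiC' i z" for z
  have holF: "F holomorphic_on strip d"
  proof -
    have "psiC i holomorphic_on strip d"
      unfolding holomorphic_on_def field_differentiable_def
      using psiC_has_field_derivative(1)[OF d] by (blast intro: has_field_derivative_at_within)
    from holomorphic_on_compose[OF this analytic_imp_holomorphic[OF f_an]]
    have "(\<lambda>z. f (psiC i z)) holomorphic_on strip d" by (simp add: o_def)
    moreover have "psiC' i holomorphic_on strip d"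
      unfolding holomorphic_on_def
      using psiC_has_field_derivative(2)[OF d] by (blast intro: field_differentiable_at_within)
    ultimately show ?thesis unfolding F_def by (rule holomorphic_on_mult)
  qed
  have F_real: "F (of_real x) = f (of_real (psiR i x)) * of_real (deriv (psiR i) x)" for x
    by (simp add: F_def psiR_properties(6)[OF i] psiC'_of_real[OF i])
  \<comment> \<open>The real line inside the strip already covers the positive axis; this makes f
    continuous there.\<close>
  have pos_image: "of_real t \<in> psiC i ` strip d" if t: "0 < t" for t
  proof -
    obtain x where "psiR i x = t" using psiR_properties(5)[OF i t] by blast
    then have "of_real t = psiC i (of_real x)" by (simp add: psiR_properties(6)[OF i])
    then show ?thesis using d by (auto simp: strip_def)
  qed
  have contf: "continuous_on {0<..} (\<lambda>t. f (of_real t))"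
    by (rule continuous_on_compose2[OF holomorphic_on_imp_continuous_on[OF analytic_imp_holomorphic[OF f_an]]])
       (auto intro!: continuous_intros pos_image)
  have intf: "(\<lambda>t. f (of_real t)) integrable_on {0..\<tau>}"
  proof (rule integrable_on_powr_bound[OF \<tau> continuous_on_subset[OF contf] pos(2)])
    fix t assume t: "t \<in> {0<..\<tau>}"
    have "cmod (f (of_real t)) \<le> K * cmod (E i \<alpha> \<beta> (of_real t))"
      using t by (intro f_bd pos_image) auto
    also have "\<dots> \<le> K * ((1 + \<tau>) powr \<bar>1 - \<alpha>\<bar> * t powr (\<alpha> - 1))"
      using t pos by (intro mult_left_mono norm_E_of_real_le[OF i]) auto
    finally show "cmod (f (of_real t)) \<le> K * (1 + \<tau>) powr \<bar>1 - \<alpha>\<bar> * t powr (\<alpha> - 1)"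
      by (simp only: mult.assoc)
  qed auto
  have lim: "((\<lambda>a. integral {a..\<xi>} (\<lambda>x. F (of_real x))) \<longlongrightarrow> integral {0..\<tau>} (\<lambda>t. f (of_real t))) at_bot"
  proof -
    have D: "(psiR i has_real_derivative deriv (psiR i) x) (at x)" for x
      using psiR_properties(1)[OF i, of x] DERIV_imp_deriv[OF psiR_properties(1)[OF i, of x]] by simp
    show ?thesis
      using improper_substitution_tendsto[where f = "\<lambda>t. f (of_real t)" and g = "psiR i" and \<xi> = \<xi>,
          OF _ contf D psiR_properties(2)[OF i] strict_mono_mono[OF psiR_properties(3)[OF i]] psiR_properties(4)[OF i]] intf
      by (simp add: \<xi> F_real)
  qed
  \<comment> \<open>The sector constant at c = 1, which multiplies 1.1 in C_i. \<open>A\<close>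
    below is the coefficient of the other term, up to factors common to both values of i.\<close>
  define B where "B = (if i = 2 then 1 else 2 powr ((1 - \<alpha> + \<bar>1 - \<alpha>\<bar>) / 2))"
  define A where "A = (if i = 2 then 1 / cos d powr ((\<alpha> + \<beta>) / 2)
     else 2 powr (1 + \<beta> / 2) * c_ad \<alpha> d / cos d powr ((\<alpha> + \<beta>) / 2))"
  have cd: "0 < cos d" "cos d \<le> 1" using d cos_gt_zero[of d] by auto
  have A0: "A \<ge> 0" and B0: "B \<ge> 0" by (auto simp: A_def B_def c_ad_def)
  have A_le: "(if i = 2 then cos d powr (- ((\<alpha> + \<beta>) / 2))
        else 2 powr ((1 - \<alpha> + \<bar>1 - \<alpha>\<bar>) / 2) * cos d powr (- ((max \<alpha> 1 + \<beta>) / 2))) \<le> A"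
    using envelope_constant_le[OF d pos(2,3)] by (simp add: A_def powr_minus_divide)
  have B_le: "(if i = 2 then 1 powr (- ((\<alpha> + \<beta>) / 2))
        else 2 powr ((1 - \<alpha> + \<bar>1 - \<alpha>\<bar>) / 2) * 1 powr (- ((max \<alpha> 1 + \<beta>) / 2))) \<le> B"
    by (simp add: B_def)
  have bd: "cmod (F z) \<le> K * A * exp (\<alpha> * Re z)" "cmod (F z) \<le> K * A * exp (- \<beta> * Re z)" if "z \<in> strip d" for z
    unfolding F_def using transformed_integrand_le[OF i pos f_bd that cd strip_sector[OF d that] A_le] by blast+
  have rbd: "cmod (F (of_real x)) \<le> K * B * exp (\<alpha> * x)" "cmod (F (of_real x)) \<le> K * B * exp (- \<beta> * x)" for x
  proof -
    have z: "of_real x \<in> strip d" using d by (simp add: strip_def)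
    have c: "1 * cmod (exp (of_real x)) \<le> Re (exp (of_real x))" by (simp add: exp_of_real)
    show "cmod (F (of_real x)) \<le> K * B * exp (\<alpha> * x)" "cmod (F (of_real x)) \<le> K * B * exp (- \<beta> * x)"
      unfolding F_def using transformed_integrand_le[OF i pos f_bd z _ _ c B_le] by simp_all
  qed
  have \<mu>: "0 < \<mu>" "\<mu> \<le> \<alpha>" "\<mu> \<le> \<beta>" using mu pos by auto
  have hpos: "h > 0" using h d \<mu> n by simp
  have MN: "\<mu> * real n \<le> \<alpha> * real_of_int M" "\<mu> * real n \<le> \<beta> * real_of_int N"
  proof -
    have le: "\<gamma> * real n \<le> \<kappa> * real_of_int \<lceil>\<gamma> * real n / \<kappa>\<rceil>" if "0 < \<kappa>" for \<gamma> \<kappa>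
    proof -
      have "\<gamma> * real n = \<kappa> * (\<gamma> * real n / \<kappa>)" using that by simp
      also have "\<dots> \<le> \<kappa> * real_of_int \<lceil>\<gamma> * real n / \<kappa>\<rceil>"
        using that by (intro mult_left_mono) auto
      finally show ?thesis .
    qed
    \<comment> \<open>One window end gives equality, the other is rounded up by the ceiling. If
      \<alpha> = \<beta>, the two prescriptions for M and N agree.\<close>
    consider "\<mu> = \<alpha>" | "\<mu> = \<beta>" using mu by (auto simp: min_def split: if_splits)
    then have "\<mu> * real n \<le> \<alpha> * real_of_int M \<and> \<mu> * real n \<le> \<beta> * real_of_int N"
    proof cases
      case 1
      then show ?thesis using MNa le[OF pos(3), of \<alpha>] by simp
    next
      case 2
      then show ?thesis using MNb le[OF pos(2), of \<beta>] by simp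
    qed
    then show "\<mu> * real n \<le> \<alpha> * real_of_int M" "\<mu> * real n \<le> \<beta> * real_of_int N" by auto
  qed
  have "cmod (integral {0..\<tau>} (\<lambda>t. f (of_real t))
          - (\<Sum>k\<in>{-M..N}. F (of_real (real_of_int k * h)) * of_real (J k h \<xi>)))
     \<le> K * A * (1 / \<alpha> + 1 / \<beta>) * (h / d) / sinh (pi * d / h) / pi
        + 1.1 * (K * B) * (exp (- \<alpha> * (real_of_int M * h)) / \<alpha> + exp (- \<beta> * (real_of_int N * h)) / \<beta>)"
    by (rule sinc_indefinite_integration_error[OF holF hpos d(1) _ _ pos(2,3) bd rbd lim])
       (use A0 B0 pos in auto)
  also have "\<dots> \<le> 2 * K / \<mu> * (A / (1 - exp (- 2 * sqrt (pi * d * \<mu>))) * sqrt (pi / (d * \<mu>)) + 1.1 * B)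
        * exp (- sqrt (pi * d * \<mu> * real n))"
    using pos by (intro error_constants_le d \<mu> n A0 B0 h MN) auto
  also have "2 * K / \<mu> * (A / (1 - exp (- 2 * sqrt (pi * d * \<mu>))) * sqrt (pi / (d * \<mu>)) + 1.1 * B) = C_const i K \<alpha> \<beta> d"
    unfolding C_const_def Let_def mu[symmetric] A_def B_def by (simp add: mult.commute)
  finally show "cmod (integral {0..\<tau>} (\<lambda>t. f (of_real t))
                 - (\<Sum>k\<in>{-M..N}. f (of_real (psiR i (real_of_int k * h)))
                        * of_real (deriv (psiR i) (real_of_int k * h))
                        * of_real (J k h (inv (psiR i) \<tau>))))
         \<le> C_const i K \<alpha> \<beta> d * exp (- sqrt (pi * d * \<mu> * real n))"
    unfolding inv F_real .
qed

end
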